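(* (Characterisation of pRHL judgments.) Let $C,D$ be almost surely terminating statements and $R,S\subseteq\mathrm{Mem}\times\mathrm{Mem}$. Then $\models_{\mathrm{pRHL}}\{R\}\ C\sim D\ \{S\}$ if and only if the eRHL judgment $\vdash\{\lambda(m_1,m_2).[(m_1,m_2)\notin R]\}\ C\sim D\ \{\lambda(m_1,m_2).[(m_1,m_2)\notin S]\}$ (with a one-element set of logical variables) is derivable.
   Context: Language. Fix a countable set $\mathrm{Var}$ of program variables and a countable set $\mathrm{Val}$ of values; a memory is a map $m:\mathrm{Var}\to\mathrm{Val}$, and $\mathrm{Mem}$ is the (discrete) set of memories; $m[x\mapsto v]$ is the update of $m$. For a countable set $A$, a sub-distribution is $d:A\to[0,1]$ with $|d|:=\sum_a d(a)\le1$ (full if $|d|=1$); $\mathbb{E}_d[f]:=\sum_a d(a)f(a)\in[0,\infty]$; $\delta_a$ is the Dirac distribution. Statements: $C ::= \mathtt{skip} \mid x\leftarrow e \mid x \xleftarrow{\$} s \mid C;C \mid \mathtt{if}\ b\ \mathtt{then}\ C\ \mathtt{else}\ C \mid \mathtt{while}\ b\ \mathtt{do}\ C$, with $[\![e]\!]_m\in\mathrm{Val}$, $[\![b]\!]_m\in\{\mathrm{true},\mathrm{false}\}$, $[\![s]\!]_m$ a full distribution on $\mathrm{Val}$. Semantics $[\![C]\!]_m$ (sub-distribution on $\mathrm{Mem}$): $[\![\mathtt{skip}]\!]_m=\delta_m$; $[\![x\leftarrow e]\!]_m=\delta_{m[x\mapsto[\![e]\!]_m]}$; $[\![x\xleftarrow{\$}s]\!]_m$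 is the image of $[\![s]\!]_m$ under $v\mapsto m[x\mapsto v]$; $[\![C;D]\!]_m=\sum_{m'}[\![C]\!]_m(m')[\![D]\!]_{m'}$; conditionals select a branch by $[\![b]\!]_m$; $[\![\mathtt{while}\ b\ \mathtt{do}\ C]\!]_m=\sup_i[\![\mathtt{while}^i]\!]_m$ with $\mathtt{while}^0$ the zero sub-distribution and $[\![\mathtt{while}^{i+1}]\!]_m=\sum_{m'}[\![C]\!]_m(m')[\![\mathtt{while}^i]\!]_{m'}$ if $[\![b]\!]_m$, else $\delta_m$. $C$ is almost surely terminating (a.s.t.) if $[\![C]\!]_m$ is full for all $m$. Sequencing is taken with $\mathtt{skip}$ as syntactic unit. $\star$-couplings: $A^\star=A\uplus\{\star\}$; $d^\star$ extends $d$ by $d^\star(\star)=1-|d|$; a $\star$-coupling of $d_1,d_2$ is a full distribution on $A_1^\star\times A_2^\star$ with marginals $d_1^\star,d_2^\star$; a coupling of $d_1,d_2$ is a sub-distribution on $A_1\times A_2$ with marginals $d_1,d_2$. For $\Psi:Z\to\mathrm{Mem}\times\mathrm{Mem}\to[0,\infty]$, $\Psi^\star z(m_1,m_2)=\Psi z(m_1,m_2)$ if $m_1,m_2\in\mathrm{Mem}$, else $0$. For a predicate $P$ on $\mathrm{Mem}\times\mathrm{Mem}$, $P\triangleright\Phi$ equals $\Phi$ where $P$ holds and $\infty$ elsewhere; $[P]$ is the $0/1$ indicator. Write $b_1:=[\![b]\!]_{m_1}$, $b'_2:=[\![b']\!]_{m_2}$. pRHL validity: $\models_{\mathrm{pRHL}}\{R\}C\sim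 D\{S\}$ iff for all $(m_1,m_2)\in R$ there is a coupling $\mu$ of $[\![C]\!]_{m_1}$ and $[\![D]\!]_{m_2}$ with $\mathrm{supp}(\mu)\subseteq S$. Deductive system eRHL: judgments $\vdash_Z\{\Phi\}C\sim D\{\Psi\}$ ($Z$ nonempty, $\Phi,\Psi:Z\to\mathrm{Mem}\times\mathrm{Mem}\to[0,\infty]$; $Z$ omitted means a one-element set) are derivable if obtained by the rules: (Skip) $\vdash_Z\{\Phi\}\mathtt{skip}\sim\mathtt{skip}\{\Phi\}$. (Asgn) $\vdash_Z\{\lambda z(m_1,m_2).\Phi z(m_1[x\mapsto[\![e]\!]_{m_1}],m_2[y\mapsto[\![e']\!]_{m_2}])\}\ x\leftarrow e\sim y\leftarrow e'\ \{\Phi\}$. (Sample) if $\mu(m_1,m_2)$ is a coupling of $[\![s]\!]_{m_1},[\![s']\!]_{m_2}$ for all $m_1,m_2$: $\vdash_Z\{\lambda z(m_1,m_2).\mathbb{E}_{(v_1,v_2)\sim\mu(m_1,m_2)}[\Phi z(m_1[x\mapsto v_1],m_2[y\mapsto v_2])]\}\ x\xleftarrow{\$}s\sim y\xleftarrow{\$}s'\ \{\Phi\}$. (If) from $\vdash_Z\{(b_1\wedge b'_2)\triangleright\Phi\}C_1\sim D_1\{\Psi\}$ and $\vdash_Z\{(\neg b_1\wedge\neg b'_2)\triangleright\Phi\}C_2\sim D_2\{\Psi\}$ infer $\vdash_Z\{(b_1\leftrightarrow b'_2)\triangleright\Phi\}\ \mathtt{if}\ b\ \mathtt{then}\ C_1\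 \mathtt{else}\ C_2\sim\mathtt{if}\ b'\ \mathtt{then}\ D_1\ \mathtt{else}\ D_2\ \{\Psi\}$. (While) from $\vdash_Z\{(b_1\wedge b'_2)\triangleright\Phi\}C\sim D\{(b_1\leftrightarrow b'_2)\triangleright\Phi\}$ infer $\vdash_Z\{(b_1\leftrightarrow b'_2)\triangleright\Phi\}\ \mathtt{while}\ b\ \mathtt{do}\ C\sim\mathtt{while}\ b'\ \mathtt{do}\ D\ \{(\neg b_1\wedge\neg b'_2)\triangleright\Phi\}$. (Seq) from $\vdash_Z\{\Phi\}C_1\sim D_1\{\Theta\}$ and $\vdash_Z\{\Theta\}C_2\sim D_2\{\Psi\}$ infer $\vdash_Z\{\Phi\}C_1;C_2\sim D_1;D_2\{\Psi\}$ (with $\mathtt{skip}$ as unit). (Asgn-L) $\vdash_Z\{\lambda z(m_1,m_2).\Phi z(m_1[x\mapsto[\![e]\!]_{m_1}],m_2)\}\ x\leftarrow e\sim\mathtt{skip}\ \{\Phi\}$. (Sample-L) $\vdash_Z\{\lambda z(m_1,m_2).\mathbb{E}_{v\sim[\![s]\!]_{m_1}}[\Phi z(m_1[x\mapsto v],m_2)]\}\ x\xleftarrow{\$}s\sim\mathtt{skip}\ \{\Phi\}$. (If-L) from $\vdash_Z\{b_1\triangleright\Phi\}C_1\sim\mathtt{skip}\{\Psi\}$ and $\vdash_Z\{\neg b_1\triangleright\Phi\}C_2\sim\mathtt{skip}\{\Psi\}$ infer $\vdash_Z\{\Phi\}\mathtt{if}\ b\ \mathtt{then}\ C_1\ \mathtt{else}\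 C_2\sim\mathtt{skip}\{\Psi\}$. (While-L) from $\vdash_Z\{b_1\triangleright\Phi\}C\sim\mathtt{skip}\{\Phi\}$ infer $\vdash_Z\{\Phi\}\mathtt{while}\ b\ \mathtt{do}\ C\sim\mathtt{skip}\{\neg b_1\triangleright\Phi\}$. (Conseq) from $\vdash_{Z'}\{\Phi'\}C\sim D\{\Psi'\}$ infer $\vdash_Z\{\Phi\}C\sim D\{\Psi\}$ provided: for all $m_1,m_2\in\mathrm{Mem}$ and sub-distributions $d_1,d_2$ on $\mathrm{Mem}$, if $\Phi'z'(m_1,m_2)\ge\inf_\mu\mathbb{E}_\mu[\Psi'^\star z']$ for all $z'\in Z'$ then $\Phi z(m_1,m_2)\ge\inf_\mu\mathbb{E}_\mu[\Psi^\star z]$ for all $z\in Z$ (infima over $\star$-couplings $\mu$ of $d_1,d_2$). (Nmod-L) if $x$ is not modified by $C$ ($m'(x)=m(x)$ whenever $m'\in\mathrm{supp}[\![C]\!]_m$), from $\vdash_{\mathrm{Val}\times Z}\{\lambda(v,z)(m_1,m_2).(m_1(x)=v)\triangleright\Phi z(m_1,m_2)\}C\sim D\{\lambda(v,z)(m_1,m_2).\Psi z(m_1[x\mapsto v],m_2)\}$ infer $\vdash_Z\{\Phi\}C\sim D\{\Psi\}$. (Strassen) if $C,D$ are a.s.t. and $R_z\subseteq\mathrm{Mem}\times\mathrm{Mem}$ ($z\in Z$), with $R_z(M)=\{m_2\mid\exists m_1\in M,(m_1,m_2)\in R_z\}$, then $\vdash_Z\{\Phi\}C\sim D\{\lambda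 z(m_1,m_2).[(m_1,m_2)\notin R_z]\}$ and $\vdash_{\mathcal{P}(\mathrm{Mem})\times Z}\{\lambda(M,z)(m_1,m_2).1+\Phi z(m_1,m_2)\}C\sim D\{\lambda(M,z)(m_1,m_2).[m_1\in M]+[m_2\notin R_z(M)]\}$ are each inferable from the other. Moreover, Asgn-L, Sample-L, If-L, While-L and Nmod-L have mirrored right versions with the roles of the two programs and of the two memory arguments swapped. *)

theory Defs
  imports "HOL-Probability.Probability" "HOL-Library.Countable"
begin

section \<open>Couplings\<close>

text \<open>Sub-distributions are the library's \<open>'a spmf\<close>. Since \<open>'a spmf\<close> is
  literally \<open>'a option pmf\<close>, where \<open>None\<close> carries the missing mass, the type \<open>'a option\<close> plays
  the role of \<open>A\<^sup>\<star>\<close> (with \<open>None\<close> as \<open>\<star>\<close>) and a sub-distribution \<open>d\<close>, read as a \<open>pmf\<close>, is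
  its own extension \<open>d\<^sup>\<star>\<close>.\<close>

definition is_coupling :: "('a \<times> 'b) spmf \<Rightarrow> 'a spmf \<Rightarrow> 'b spmf \<Rightarrow> bool" where
  "is_coupling \<mu> d1 d2 \<longleftrightarrow> map_spmf fst \<mu> = d1 \<and> map_spmf snd \<mu> = d2"

definition star_couplings :: "'a spmf \<Rightarrow> 'b spmf \<Rightarrow> ('a option \<times> 'b option) pmf set" where
  "star_couplings d1 d2 = {\<mu>. map_pmf fst \<mu> = d1 \<and> map_pmf snd \<mu> = d2}"

fun star_ext :: "('a \<times> 'b \<Rightarrow> ennreal) \<Rightarrow> 'a option \<times> 'b option \<Rightarrow> ennreal" where
  "star_ext \<psi> (Some a, Some b) = \<psi> (a, b)"
| "star_ext \<psi> _ = 0"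

definition star_inf :: "'a spmf \<Rightarrow> 'b spmf \<Rightarrow> ('a \<times> 'b \<Rightarrow> ennreal) \<Rightarrow> ennreal" where
  "star_inf d1 d2 \<psi> = (INF \<mu>\<in>star_couplings d1 d2. \<integral>\<^sup>+ p. star_ext \<psi> p \<partial>measure_pmf \<mu>)"

definition guard :: "('a \<Rightarrow> bool) \<Rightarrow> ('a \<Rightarrow> ennreal) \<Rightarrow> 'a \<Rightarrow> ennreal" (infixr \<open>\<triangleright>\<close> 60) where
  "(P \<triangleright> \<phi>) a = (if P a then \<phi> a else \<infinity>)"


section \<open>Programs\<close>

type_synonym ('x, 'v) mem = "'x \<Rightarrow> 'v"

datatype ('x, 'e, 'b, 's) stmt =
    Skip
  | Assign 'x 'e
  | Sample 'x 's
  | Seq "('x, 'e, 'b, 's) stmt" "('x, 'e, 'b, 's) stmt"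
  | If 'b "('x, 'e, 'b, 's) stmt" "('x, 'e, 'b, 's) stmt"
  | While 'b "('x, 'e, 'b, 's) stmt"

text \<open>The least congruence that makes \<open>Skip\<close> a two-sided unit of \<open>Seq\<close>. Programs are
  understood up to this congruence (see rule \<open>Unit\<close> of the proof system).\<close>

inductive unit_eq :: "('x, 'e, 'b, 's) stmt \<Rightarrow> ('x, 'e, 'b, 's) stmt \<Rightarrow> bool" where
  left: "unit_eq (Seq Skip C) C"
| right: "unit_eq (Seq C Skip) C"
| refl: "unit_eq C C"
| sym: "unit_eq C D \<Longrightarrow> unit_eq D C"
| trans: "unit_eq C D \<Longrightarrow> unit_eq D E \<Longrightarrow> unit_eq C E"
| Seq: "unit_eq C1 D1 \<Longrightarrow> unit_eq C2 D2 \<Longrightarrow> unit_eq (Seq C1 C2) (Seq D1 D2)"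
| If: "unit_eq C1 D1 \<Longrightarrow> unit_eq C2 D2 \<Longrightarrow> unit_eq (If b C1 C2) (If b D1 D2)"
| While: "unit_eq C D \<Longrightarrow> unit_eq (While b C) (While b D)"

primrec while_approx :: "('m \<Rightarrow> bool) \<Rightarrow> ('m \<Rightarrow> 'm spmf) \<Rightarrow> nat \<Rightarrow> 'm \<Rightarrow> 'm spmf" where
  "while_approx b c 0 = (\<lambda>m. return_pmf None)"
| "while_approx b c (Suc i) =
     (\<lambda>m. if b m then bind_spmf (c m) (while_approx b c i) else return_spmf m)"


section \<open>Logical variables\<close>

text \<open>An inductive predicate cannot change the type of its index set between premise and
  conclusion, so index sets \<open>Z\<close> are sets over one type that contains an arbitrary type \<open>'z\<close> and
  is closed under pairing with a value (non-modification rules) and with a set of memories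
  (Strassen rule). Everything below is polymorphic in \<open>'z\<close>, so no bound is
  imposed on the size of the index sets.\<close>

datatype ('x, 'v, 'z) lvar =
    Base 'z
  | ValPair 'v "('x, 'v, 'z) lvar"
  | SetPair "('x, 'v) mem set" "('x, 'v, 'z) lvar"

definition Val_times :: "('x, 'v, 'z) lvar set \<Rightarrow> ('x, 'v, 'z) lvar set" where
  "Val_times Z = {ValPair v z | v z. z \<in> Z}"

definition Pow_times :: "('x, 'v, 'z) lvar set \<Rightarrow> ('x, 'v, 'z) lvar set" where
  "Pow_times Z = {SetPair M z | M z. z \<in> Z}"

text \<open>Abstractions over \<open>(v, z)\<close> and \<open>(M, z)\<close>. The values outside \<open>Val_times Z\<close> and
  \<open>Pow_times Z\<close> are irrelevant, as the rule of consequence only looks at assertions on the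
  index sets.\<close>

definition val_abs :: "('v \<Rightarrow> ('x, 'v, 'z) lvar \<Rightarrow> 'c) \<Rightarrow> ('x, 'v, 'z) lvar \<Rightarrow> 'c" where
  "val_abs F w = (case w of ValPair v z \<Rightarrow> F v z | _ \<Rightarrow> undefined)"

definition set_abs :: "(('x, 'v) mem set \<Rightarrow> ('x, 'v, 'z) lvar \<Rightarrow> 'c) \<Rightarrow> ('x, 'v, 'z) lvar \<Rightarrow> 'c" where
  "set_abs F w = (case w of SetPair M z \<Rightarrow> F M z | _ \<Rightarrow> undefined)"


section \<open>Semantics and proof system\<close>

text \<open>Expressions, guards and samplers are arbitrary syntactic classes with a given
  interpretation; \<open>'v pmf\<close> is the type of full distributions.\<close>

locale lang =
  fixes ev :: "'e \<Rightarrow> ('x::countable, 'v::countable) mem \<Rightarrow> 'v"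
    and bv :: "'b \<Rightarrow> ('x, 'v) mem \<Rightarrow> bool"
    and sv :: "'s \<Rightarrow> ('x, 'v) mem \<Rightarrow> 'v pmf"
begin

primrec sem :: "('x, 'e, 'b, 's) stmt \<Rightarrow> ('x, 'v) mem \<Rightarrow> ('x, 'v) mem spmf" where
  "sem Skip = (\<lambda>m. return_spmf m)"
| "sem (Assign x e) = (\<lambda>m. return_spmf (m(x := ev e m)))"
| "sem (Sample x s) = (\<lambda>m. spmf_of_pmf (map_pmf (\<lambda>v. m(x := v)) (sv s m)))"
| "sem (Seq C D) = (\<lambda>m. bind_spmf (sem C m) (sem D))"
| "sem (If b C D) = (\<lambda>m. if bv b m then sem C m else sem D m)"
| "sem (While b C) = (\<lambda>m. lub_spmf (range (\<lambda>i. while_approx (bv b) (sem C) i m)))"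

text \<open>\<open>lub_spmf\<close> is the pointwise supremum only for chains; the approximants do form one.\<close>

lemma while_approx_step:
  "ord_spmf (=) (while_approx b c i m) (while_approx b c (Suc i) m)"
proof (induction i arbitrary: m)
  case 0
  show ?case by simp
next
  case (Suc i)
  have "ord_spmf (=) (bind_spmf (c m) (while_approx b c i))
          (bind_spmf (c m) (while_approx b c (Suc i)))"
    by (rule ord_spmf_bind_reflI) (rule Suc.IH)
  then show ?case
    by (subst (1 2) while_approx.simps(2)) (simp only: ord_spmf_reflI split: if_split, simp)
qed

lemma while_approx_mono:
  assumes "i \<le> j"
  shows "ord_spmf (=) (while_approx b c i m) (while_approx b c j m)"
  using assms
proof (induction j rule: dec_induct)
  case base
  show ?case by (simp add: ord_spmf_reflI)
next
  case (step j)
  show ?case by (rule spmf.leq_trans[OF step.IH while_approx_step])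
qed

lemma spmf_sem_While:
  "spmf (sem (While b C) m) m' = (SUP i. spmf (while_approx (bv b) (sem C) i m) m')"
proof -
  have "Complete_Partial_Order.chain (ord_spmf (=)) (range (\<lambda>i. while_approx (bv b) (sem C) i m))"
  proof (rule chainI, elim rangeE)
    fix p q i j
    assume "p = while_approx (bv b) (sem C) i m" "q = while_approx (bv b) (sem C) j m"
    then show "ord_spmf (=) p q \<or> ord_spmf (=) q p"
      using while_approx_mono[of i j "bv b" "sem C" m] while_approx_mono[of j i "bv b" "sem C" m]
        nat_le_linear[of i j] by metis
  qed
  then show ?thesis by (simp add: spmf_lub_spmf image_comp)
qed

definition ast :: "('x, 'e, 'b, 's) stmt \<Rightarrow> bool" where
  "ast C \<longleftrightarrow> (\<forall>m. lossless_spmf (sem C m))"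

definition unmodified :: "'x \<Rightarrow> ('x, 'e, 'b, 's) stmt \<Rightarrow> bool" where
  "unmodified x C \<longleftrightarrow> (\<forall>m. \<forall>m'\<in>set_spmf (sem C m). m' x = m x)"

definition pRHL_valid ::
  "(('x, 'v) mem \<times> ('x, 'v) mem) set \<Rightarrow> ('x, 'e, 'b, 's) stmt \<Rightarrow> ('x, 'e, 'b, 's) stmt
    \<Rightarrow> (('x, 'v) mem \<times> ('x, 'v) mem) set \<Rightarrow> bool" where
  "pRHL_valid R C D S \<longleftrightarrow>
     (\<forall>(m1, m2)\<in>R. \<exists>\<mu>. is_coupling \<mu> (sem C m1) (sem D m2) \<and> set_spmf \<mu> \<subseteq> S)"

inductive eRHL ::
  "('x, 'v, 'z) lvar set
    \<Rightarrow> (('x, 'v, 'z) lvar \<Rightarrow> ('x, 'v) mem \<times> ('x, 'v) mem \<Rightarrow> ennreal)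
    \<Rightarrow> ('x, 'e, 'b, 's) stmt \<Rightarrow> ('x, 'e, 'b, 's) stmt
    \<Rightarrow> (('x, 'v, 'z) lvar \<Rightarrow> ('x, 'v) mem \<times> ('x, 'v) mem \<Rightarrow> ennreal) \<Rightarrow> bool" where
  Skip: "Z \<noteq> {} \<Longrightarrow> eRHL Z \<Phi> Skip Skip \<Phi>"
| Asgn: "Z \<noteq> {} \<Longrightarrow>
    eRHL Z (\<lambda>z (m1, m2). \<Phi> z (m1(x := ev e m1), m2(y := ev e' m2)))
      (Assign x e) (Assign y e') \<Phi>"
| Sample: "Z \<noteq> {} \<Longrightarrow>
    \<forall>m1 m2. is_coupling (\<mu> m1 m2) (spmf_of_pmf (sv s m1)) (spmf_of_pmf (sv s' m2)) \<Longrightarrow>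
    eRHL Z (\<lambda>z (m1, m2). \<integral>\<^sup>+ (v1, v2). \<Phi> z (m1(x := v1), m2(y := v2)) \<partial>measure_spmf (\<mu> m1 m2))
      (Sample x s) (Sample y s') \<Phi>"
| If: "eRHL Z (\<lambda>z. (\<lambda>(m1, m2). bv b m1 \<and> bv b' m2) \<triangleright> \<Phi> z) C1 D1 \<Psi> \<Longrightarrow>
    eRHL Z (\<lambda>z. (\<lambda>(m1, m2). \<not> bv b m1 \<and> \<not> bv b' m2) \<triangleright> \<Phi> z) C2 D2 \<Psi> \<Longrightarrow>
    eRHL Z (\<lambda>z. (\<lambda>(m1, m2). bv b m1 \<longleftrightarrow> bv b' m2) \<triangleright> \<Phi> z) (If b C1 C2) (If b' D1 D2) \<Psi>"
| While: "eRHL Z (\<lambda>z. (\<lambda>(m1, m2). bv b m1 \<and> bv b' m2) \<triangleright> \<Phi> z) C D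
      (\<lambda>z. (\<lambda>(m1, m2). bv b m1 \<longleftrightarrow> bv b' m2) \<triangleright> \<Phi> z) \<Longrightarrow>
    eRHL Z (\<lambda>z. (\<lambda>(m1, m2). bv b m1 \<longleftrightarrow> bv b' m2) \<triangleright> \<Phi> z) (While b C) (While b' D)
      (\<lambda>z. (\<lambda>(m1, m2). \<not> bv b m1 \<and> \<not> bv b' m2) \<triangleright> \<Phi> z)"
| Seq: "eRHL Z \<Phi> C1 D1 \<Theta> \<Longrightarrow> eRHL Z \<Theta> C2 D2 \<Psi> \<Longrightarrow> eRHL Z \<Phi> (Seq C1 C2) (Seq D1 D2) \<Psi>"
| Unit: "eRHL Z \<Phi> C D \<Psi> \<Longrightarrow> unit_eq C C' \<Longrightarrow> unit_eq D D' \<Longrightarrow> eRHL Z \<Phi> C' D' \<Psi>"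
| Asgn_L: "Z \<noteq> {} \<Longrightarrow>
    eRHL Z (\<lambda>z (m1, m2). \<Phi> z (m1(x := ev e m1), m2)) (Assign x e) Skip \<Phi>"
| Asgn_R: "Z \<noteq> {} \<Longrightarrow>
    eRHL Z (\<lambda>z (m1, m2). \<Phi> z (m1, m2(y := ev e m2))) Skip (Assign y e) \<Phi>"
| Sample_L: "Z \<noteq> {} \<Longrightarrow>
    eRHL Z (\<lambda>z (m1, m2). \<integral>\<^sup>+ v. \<Phi> z (m1(x := v), m2) \<partial>measure_pmf (sv s m1))
      (Sample x s) Skip \<Phi>"
| Sample_R: "Z \<noteq> {} \<Longrightarrow>
    eRHL Z (\<lambda>z (m1, m2). \<integral>\<^sup>+ v. \<Phi> z (m1, m2(y := v)) \<partial>measure_pmf (sv s m2))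
      Skip (Sample y s) \<Phi>"
| If_L: "eRHL Z (\<lambda>z. (\<lambda>(m1, m2). bv b m1) \<triangleright> \<Phi> z) C1 Skip \<Psi> \<Longrightarrow>
    eRHL Z (\<lambda>z. (\<lambda>(m1, m2). \<not> bv b m1) \<triangleright> \<Phi> z) C2 Skip \<Psi> \<Longrightarrow>
    eRHL Z \<Phi> (If b C1 C2) Skip \<Psi>"
| If_R: "eRHL Z (\<lambda>z. (\<lambda>(m1, m2). bv b m2) \<triangleright> \<Phi> z) Skip D1 \<Psi> \<Longrightarrow>
    eRHL Z (\<lambda>z. (\<lambda>(m1, m2). \<not> bv b m2) \<triangleright> \<Phi> z) Skip D2 \<Psi> \<Longrightarrow>
    eRHL Z \<Phi> Skip (If b D1 D2) \<Psi>"
| While_L: "eRHL Z (\<lambda>z. (\<lambda>(m1, m2). bv b m1) \<triangleright> \<Phi> z) C Skip \<Phi> \<Longrightarrow>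
    eRHL Z \<Phi> (While b C) Skip (\<lambda>z. (\<lambda>(m1, m2). \<not> bv b m1) \<triangleright> \<Phi> z)"
| While_R: "eRHL Z (\<lambda>z. (\<lambda>(m1, m2). bv b m2) \<triangleright> \<Phi> z) Skip D \<Phi> \<Longrightarrow>
    eRHL Z \<Phi> Skip (While b D) (\<lambda>z. (\<lambda>(m1, m2). \<not> bv b m2) \<triangleright> \<Phi> z)"
| Conseq: "eRHL Z' \<Phi>' C D \<Psi>' \<Longrightarrow> Z \<noteq> {} \<Longrightarrow>
    \<forall>m1 m2 d1 d2. (\<forall>z'\<in>Z'. \<Phi>' z' (m1, m2) \<ge> star_inf d1 d2 (\<Psi>' z'))
      \<longrightarrow> (\<forall>z\<in>Z. \<Phi> z (m1, m2) \<ge> star_inf d1 d2 (\<Psi> z)) \<Longrightarrow>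
    eRHL Z \<Phi> C D \<Psi>"
| Nmod_L: "unmodified x C \<Longrightarrow>
    eRHL (Val_times Z) (val_abs (\<lambda>v z. (\<lambda>(m1, m2). m1 x = v) \<triangleright> \<Phi> z)) C D
      (val_abs (\<lambda>v z (m1, m2). \<Psi> z (m1(x := v), m2))) \<Longrightarrow>
    eRHL Z \<Phi> C D \<Psi>"
| Nmod_R: "unmodified y D \<Longrightarrow>
    eRHL (Val_times Z) (val_abs (\<lambda>v z. (\<lambda>(m1, m2). m2 y = v) \<triangleright> \<Phi> z)) C D
      (val_abs (\<lambda>v z (m1, m2). \<Psi> z (m1, m2(y := v)))) \<Longrightarrow>
    eRHL Z \<Phi> C D \<Psi>"
| Strassen_down: "ast C \<Longrightarrow> ast D \<Longrightarrow>
    eRHL Z \<Phi> C D (\<lambda>z (m1, m2). of_bool ((m1, m2) \<notin> R z)) \<Longrightarrow>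
    eRHL (Pow_times Z) (set_abs (\<lambda>M z (m1, m2). 1 + \<Phi> z (m1, m2))) C D
      (set_abs (\<lambda>M z (m1, m2). of_bool (m1 \<in> M) + of_bool (m2 \<notin> R z `` M)))"
| Strassen_up: "ast C \<Longrightarrow> ast D \<Longrightarrow>
    eRHL (Pow_times Z) (set_abs (\<lambda>M z (m1, m2). 1 + \<Phi> z (m1, m2))) C D
      (set_abs (\<lambda>M z (m1, m2). of_bool (m1 \<in> M) + of_bool (m2 \<notin> R z `` M))) \<Longrightarrow>
    eRHL Z \<Phi> C D (\<lambda>z (m1, m2). of_bool ((m1, m2) \<notin> R z))"

end

end

theory Submission
  imports Defs
begin

text \<open>
  Soundness: derivability of \<open>{\<Phi>} C \<sim> D {\<Psi>}\<close> implies that the infimum over \<open>\<star>\<close>-couplings of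
  the expectation of \<open>\<Psi>\<close> is at most \<open>\<Phi>\<close>. Couplings with converging marginals have a pointwise
  convergent subsequence whose limit couples the limit marginals, and by Fatou's lemma expectations
  do not increase in the limit. Hence the infimum is attained, which gives the sequencing rule, and
  the bound passes from the finite unrollings of a loop to the loop. The upward Strassen rule is a
  Hall-type theorem for real weights, proved for finite supports
    and transferred to countable ones by
  truncation. On \<open>R\<close> the precondition \<open>[\<notin> R]\<close> vanishes, so an optimal coupling lives on \<open>S\<close>.

  Completeness: after the Strassen rule the postcondition is \<open>[m1 \<in> M] + [m2 \<notin> S(M)]\<close>, whose
  expectation depends only on the marginals. It is therefore enough to run \<open>C\<close> against \<open>skip\<close> and
  then \<open>skip\<close> against \<open>D\<close>, and the one-sided rules derive exact expectations.
\<close>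

section \<open>Strassen's theorem\<close>

text \<open>Read \<open>p\<close> as supplies, \<open>q\<close> as capacities and \<open>f\<close>
  as a flow along \<open>R\<close>. Induction on \<open>card A + card B\<close>: if a weight
  vanishes, its row or column is deleted; if a proper nonempty \<open>M\<close> meets the Hall
  condition with equality, the instance splits in two. Any instance with a positive supply is
  brought into such a position by pushing as much flow as possible along one edge.\<close>

lemma fractional_hall:
  fixes p :: "'a \<Rightarrow> real" and q :: "'b \<Rightarrow> real"
  assumes "finite A" "finite B" "\<And>a. a \<in> A \<Longrightarrow> 0 \<le> p a" "\<And>b. b \<in> B \<Longrightarrow> 0 \<le> q b"
    and "\<And>M. M \<subseteq> A \<Longrightarrow> sum p M \<le> sum q (B \<inter> R `` M)"
  shows "\<exists>f. (\<forall>a b. 0 \<le> f a b) \<and> (\<forall>a b. f a b \<noteq> 0 \<longrightarrow> a \<in> A \<and> b \<in> B \<and> (a, b) \<in> R) \<and>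
    (\<forall>a\<in>A. (\<Sum>b\<in>B. f a b) = p a) \<and> (\<forall>b\<in>B. (\<Sum>a\<in>A. f a b) \<le> q b)"
  using assms
proof (induction "card A + card B" arbitrary: A B p q rule: less_induct)
  case less
  let ?flow = "\<lambda>(A :: 'a set) (B :: 'b set) (p :: 'a \<Rightarrow> real) (q :: 'b \<Rightarrow> real) f.
    (\<forall>a b. 0 \<le> f a b) \<and> (\<forall>a b. f a b \<noteq> 0 \<longrightarrow> a \<in> A \<and> b \<in> B \<and> (a, b) \<in> R) \<and>
    (\<forall>a\<in>A. (\<Sum>b\<in>B. f a b) = p a) \<and> (\<forall>b\<in>B. (\<Sum>a\<in>A. f a b) \<le> q b)"
  note fin = \<open>finite A\<close> \<open>finite B\<close>
  \<comment> \<open>Stated for all weights on the fixed \<open>A\<close> and \<open>B\<close>, since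
    it is applied both to the given weights and to those left after pushing flow along an edge. The
    sets shrink only inside this step.\<close>
  have degenerate: "\<exists>f. ?flow A B p q f"
    if nn: "\<And>a. a \<in> A \<Longrightarrow> 0 \<le> p a" "\<And>b. b \<in> B \<Longrightarrow> 0 \<le> q b"
    and hall: "\<And>M. M \<subseteq> A \<Longrightarrow> sum p M \<le> sum q (B \<inter> R `` M)"
    and deg: "(\<exists>a\<in>A. p a = 0) \<or> (\<exists>b\<in>B. q b = 0) \<or>
      (\<exists>M. M \<subseteq> A \<and> M \<noteq> {} \<and> M \<noteq> A \<and> sum p M = sum q (B \<inter> R `` M))" for p :: "'a \<Rightarrow> real" and q :: "'b \<Rightarrow> real"
    using deg
  proof (elim disjE exE bexE conjE)
    fix a assume a: "a \<in> A" "p a = 0"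
    have "\<exists>f. ?flow (A - {a}) B p q f"
    proof (rule less.hyps)
      show "card (A - {a}) + card B < card A + card B"
        using card_Diff1_less[OF fin(1) a(1)] by linarith
      show "sum p M \<le> sum q (B \<inter> R `` M)" if "M \<subseteq> A - {a}" for M
        using that by (intro hall) auto
    qed (use fin nn in auto)
    then obtain f where f: "?flow (A - {a}) B p q f" by blast
    have 0: "f a b = 0" for b using f by blast
    have "(\<Sum>a\<in>A. f a b) = (\<Sum>a\<in>A - {a}. f a b)" for b
      using 0 a fin by (simp add: sum.remove)
    then have "?flow A B p q f" using f 0 a
      by (smt (verit) Diff_iff insert_iff empty_iff sum.neutral)
    then show ?thesis by blast
  next
    fix b assume b: "b \<in> B" "q b = 0"
    have "\<exists>f. ?flow A (B - {b}) p q f"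
    proof (rule less.hyps)
      show "card A + card (B - {b}) < card A + card B"
        using card_Diff1_less[OF fin(2) b(1)] by linarith
      show "sum p M \<le> sum q ((B - {b}) \<inter> R `` M)" if "M \<subseteq> A" for M
      proof -
        have "sum q ((B - {b}) \<inter> R `` M) = sum q (B \<inter> R `` M)"
          by (rule sum.mono_neutral_left) (use fin b in auto)
        then show ?thesis using hall[OF that] by simp
      qed
    qed (use fin nn in auto)
    then obtain f where f: "?flow A (B - {b}) p q f" by blast
    have 0: "f a b = 0" for a using f by blast
    have "(\<Sum>b\<in>B. f a b) = (\<Sum>b\<in>B - {b}. f a b)" for a
      using 0 b fin by (simp add: sum.remove)
    then have "?flow A B p q f" using f 0 b
      by (smt (verit) Diff_iff insert_iff empty_iff sum.neutral)
    then show ?thesis by blast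
  next
    \<comment> \<open>A tight \<open>M\<close> uses up the whole capacity of its neighbours. So
      \<open>M\<close> with its neighbours, and the complement with the remaining columns, are two
      independent smaller instances whose flows add up.\<close>
    fix M assume M: "M \<subseteq> A" "M \<noteq> {}" "M \<noteq> A" and tight: "sum p M = sum q (B \<inter> R `` M)"
    have finM: "finite M" using M fin finite_subset by blast
    have cM: "card M < card A" "card (A - M) < card A"
      using M fin by (auto intro!: psubset_card_mono)
    have cB: "card (B \<inter> R `` M) \<le> card B" "card (B - R `` M) \<le> card B"
      using fin by (auto intro!: card_mono)
    have "\<exists>f. ?flow M (B \<inter> R `` M) p q f"
    proof (rule less.hyps)
      show "sum p N \<le> sum q (B \<inter> R `` M \<inter> R `` N)" if "N \<subseteq> M" for N
      proof -
        have "B \<inter> R `` M \<inter> R `` N = B \<inter> R `` N" using that by blast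
        then show ?thesis using hall[of N] that M by simp
      qed
    qed (use cM cB fin finM nn M in auto)
    then obtain f1 where f1: "?flow M (B \<inter> R `` M) p q f1" by blast
    have "\<exists>f. ?flow (A - M) (B - R `` M) p q f"
    proof (rule less.hyps)
      show "sum p N \<le> sum q ((B - R `` M) \<inter> R `` N)" if "N \<subseteq> A - M" for N
      proof -
        have finN: "finite N" using that fin finite_subset by blast
        \<comment> \<open>Hall's condition for the remainder: apply the given condition to
          \<open>N \<union> M\<close> and cancel the equality for \<open>M\<close>.\<close>
        have "sum p N + sum p M = sum p (N \<union> M)"
          using that finM finN by (subst sum.union_disjoint) auto
        also have "\<dots> \<le> sum q (B \<inter> R `` (N \<union> M))" using that M by (intro hall) auto
        also have "B \<inter> R `` (N \<union> M) = ((B - R `` M) \<inter> R `` N) \<union> (B \<inter> R `` M)" by blast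
        also have "sum q \<dots> = sum q ((B - R `` M) \<inter> R `` N) + sum q (B \<inter> R `` M)"
          using fin by (intro sum.union_disjoint) auto
        finally show ?thesis using tight by simp
      qed
    qed (use cM cB fin nn in auto)
    then obtain f2 where f2: "?flow (A - M) (B - R `` M) p q f2" by blast
    let ?f = "\<lambda>a b. f1 a b + f2 a b"
    have z1: "f1 a b = 0" if "a \<notin> M \<or> b \<notin> B \<inter> R `` M" for a b using f1 that by blast
    have z2: "f2 a b = 0" if "a \<in> M \<or> b \<in> R `` M" for a b using f2 that by blast
    have "(\<Sum>b\<in>B. ?f a b) = p a" if "a \<in> A" for a
    proof (cases "a \<in> M")
      case True
      have "(\<Sum>b\<in>B. ?f a b) = (\<Sum>b\<in>B \<inter> R `` M. f1 a b)"
        by (rule sum.mono_neutral_cong_right) (use True z1 z2 fin in auto)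
      then show ?thesis using f1 True by simp
    next
      case False
      have "(\<Sum>b\<in>B. ?f a b) = (\<Sum>b\<in>B - R `` M. f2 a b)"
        by (rule sum.mono_neutral_cong_right) (use False z1 z2 fin in auto)
      then show ?thesis using f2 False that by simp
    qed
    moreover have "(\<Sum>a\<in>A. ?f a b) \<le> q b" if "b \<in> B" for b
    proof (cases "b \<in> R `` M")
      case True
      have "(\<Sum>a\<in>A. ?f a b) = (\<Sum>a\<in>M. f1 a b)"
        by (rule sum.mono_neutral_cong_right) (use True z1 z2 fin M in auto)
      then show ?thesis using f1 True that by simp
    next
      case False
      have "(\<Sum>a\<in>A. ?f a b) = (\<Sum>a\<in>A - M. f2 a b)"
        by (rule sum.mono_neutral_cong_right) (use False z1 z2 fin M in auto)
      then show ?thesis using f2 False that by simp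
    qed
    moreover have "0 \<le> ?f a b" for a b using f1 f2 by (meson add_nonneg_nonneg)
    moreover have "a \<in> A \<and> b \<in> B \<and> (a, b) \<in> R" if "?f a b \<noteq> 0" for a b
    proof -
      from that have "f1 a b \<noteq> 0 \<or> f2 a b \<noteq> 0" by auto
      then show ?thesis using f1 f2 M by blast
    qed
    ultimately have "?flow A B p q ?f" by blast
    then show ?thesis by (rule exI[of _ ?f])
  qed
  show ?case
  proof (cases "A = {}")
    case True
    then show ?thesis using less.prems by (intro exI[of _ "\<lambda>_ _. 0"]) auto
  next
    case False
    then obtain a where a: "a \<in> A" by blast
    show ?thesis
    proof (cases "p a = 0")
      case True
      then show ?thesis using a by (intro degenerate less.prems) auto
    next
      case False
      then have "0 < p a" using less.prems(3)[OF a] by simp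
      also have "p a \<le> sum q (B \<inter> R `` {a})" using less.prems(5)[of "{a}"] a by simp
      finally have "B \<inter> R `` {a} \<noteq> {}" by force
      then obtain b where b: "b \<in> B" "(a, b) \<in> R" by blast
      \<comment> \<open>Lowering \<open>p a\<close> and \<open>q b\<close> by the same amount
        preserves Hall's condition for every set that contains \<open>a\<close> or is not adjacent
        to \<open>b\<close>. Only the sets in \<open>Ms\<close> lose slack.\<close>
      define Ms where "Ms = {M. M \<subseteq> A \<and> b \<in> R `` M \<and> a \<notin> M}"
      define slack where "slack M = sum q (B \<inter> R `` M) - sum p M" for M
      define T where "T = insert (p a) (insert (q b) (slack ` Ms))"
      \<comment> \<open>The largest admissible amount: a supply, a capacity or the slack of some set
        then drops to zero, which is what \<open>degenerate\<close> asks for.\<close>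
      define t where "t = Min T"
      have finT: "finite T" "T \<noteq> {}" using fin by (auto simp: T_def Ms_def)
      have tT: "t \<in> T" unfolding t_def using finT by (rule Min_in)
      have tle: "t \<le> s" if "s \<in> T" for s unfolding t_def using finT that by simp
      have t0: "0 \<le> t" using tT less.prems a b by (auto simp: T_def slack_def Ms_def)
      define p' where "p' = p(a := p a - t)"
      define q' where "q' = q(b := q b - t)"
      have sp: "sum p' M = sum p M - (if a \<in> M then t else 0)" if "finite M" for M
      proof (cases "a \<in> M")
        case True
        then have "sum p' M = p' a + sum p' (M - {a})" "sum p M = p a + sum p (M - {a})"
          using that by (simp_all add: sum.remove)
        moreover have "sum p' (M - {a}) = sum p (M - {a})" by (rule sum.cong) (auto simp: p'_def)
        ultimately show ?thesis using True by (simp add: p'_def)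
      next
        case False
        then show ?thesis by (auto simp: p'_def intro!: sum.cong)
      qed
      have sq: "sum q' M = sum q M - (if b \<in> M then t else 0)" if "finite M" for M
      proof (cases "b \<in> M")
        case True
        then have "sum q' M = q' b + sum q' (M - {b})" "sum q M = q b + sum q (M - {b})"
          using that by (simp_all add: sum.remove)
        moreover have "sum q' (M - {b}) = sum q (M - {b})" by (rule sum.cong) (auto simp: q'_def)
        ultimately show ?thesis using True by (simp add: q'_def)
      next
        case False
        then show ?thesis by (auto simp: q'_def intro!: sum.cong)
      qed
      have "\<exists>f. ?flow A B p' q' f"
      proof (rule degenerate)
        show "0 \<le> p' c" if "c \<in> A" for c
          using less.prems(3)[OF that] tle[of "p a"] by (auto simp: p'_def T_def)
        show "0 \<le> q' c" if "c \<in> B" for c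
          using less.prems(4)[OF that] tle[of "q b"] by (auto simp: q'_def T_def)
        show "sum p' M \<le> sum q' (B \<inter> R `` M)" if M: "M \<subseteq> A" for M
        proof -
          have f: "finite M" "finite (B \<inter> R `` M)" using M fin finite_subset by auto
          show ?thesis
          proof (cases "a \<in> M")
            case True
            then have "b \<in> B \<inter> R `` M" using b by blast
            then show ?thesis using True less.prems(5)[OF M] f by (simp add: sp sq)
          next
            case False
            show ?thesis
            proof (cases "b \<in> R `` M")
              case True
              then have "slack M \<in> T" using M False by (auto simp: T_def Ms_def)
              from tle[OF this] show ?thesis using f False t0 by (simp add: sp sq slack_def)
            next
              case F: False
              then show ?thesis using f False less.prems(5)[OF M] by (simp add: sp sq)
            qed
          qed
        qed
        from tT consider "t = p a" | "t = q b" | M where "M \<in> Ms" "t = slack M"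
          by (auto simp: T_def)
        then show "(\<exists>a\<in>A. p' a = 0) \<or> (\<exists>b\<in>B. q' b = 0) \<or>
          (\<exists>M. M \<subseteq> A \<and> M \<noteq> {} \<and> M \<noteq> A \<and> sum p' M = sum q' (B \<inter> R `` M))"
        proof cases
          case 1
          then show ?thesis using a by (auto simp: p'_def)
        next
          case 2
          then show ?thesis using b by (auto simp: q'_def)
        next
          case 3
          \<comment> \<open>\<open>M\<close> is nonempty because \<open>b\<close> is one of its
            neighbours, and proper because it misses \<open>a\<close>.\<close>
          then have M: "M \<subseteq> A" "b \<in> R `` M" "a \<notin> M" by (auto simp: Ms_def)
          have "finite M" "finite (B \<inter> R `` M)" using M fin finite_subset by auto
          then have "sum p' M = sum q' (B \<inter> R `` M)" using M b 3 by (simp add: sp sq slack_def)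
          then show ?thesis using M a by blast
        qed
      qed
      then obtain f where f: "?flow A B p' q' f" by blast
      let ?f = "\<lambda>c d. f c d + (if c = a \<and> d = b then t else 0)"
      have "(\<Sum>d\<in>B. ?f c d) = p c" if "c \<in> A" for c
        using f that b fin by (cases "c = a") (auto simp: sum.distrib p'_def)
      moreover have "(\<Sum>c\<in>A. ?f c d) \<le> q d" if "d \<in> B" for d
      proof -
        have "(\<Sum>c\<in>A. f c d) \<le> q' d" using f that by blast
        then show ?thesis
          using f that a fin by (cases "d = b") (auto simp: sum.distrib q'_def)
      qed
      moreover have "0 \<le> ?f c d" for c d using f t0 by (auto intro!: add_nonneg_nonneg)
      moreover have "c \<in> A \<and> d \<in> B \<and> (c, d) \<in> R" if "?f c d \<noteq> 0" for c d
        using that f a b by (cases "c = a \<and> d = b") auto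
      ultimately have "?flow A B p q ?f" by blast
      then show ?thesis by (rule exI[of _ ?f])
    qed
  qed
qed

section \<open>From finite flows to couplings of countably supported distributions\<close>

text \<open>Tonelli's theorem for counting measures, valid on types of any size, turns the row sums
  into total mass one, so \<open>embed_pmf\<close> applies. The same exchange of sums gives the
  marginals.\<close>

lemma pmf_with_marginals:
  fixes g :: "'a \<times> 'b \<Rightarrow> real"
  assumes nn: "\<And>x. 0 \<le> g x"
    and row: "\<And>a. (\<integral>\<^sup>+ b. g (a, b) \<partial>count_space UNIV) = pmf p a"
    and col: "\<And>b. (\<integral>\<^sup>+ a. g (a, b) \<partial>count_space UNIV) = pmf q b"
  shows "\<exists>\<mu>. (\<forall>x. pmf \<mu> x = g x) \<and> map_pmf fst \<mu> = p \<and> map_pmf snd \<mu> = q"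
proof (intro exI[of _ "embed_pmf g"] conjI allI)
  have tot: "(\<integral>\<^sup>+ x. g x \<partial>count_space UNIV) = 1"
  proof -
    have "(\<integral>\<^sup>+ x. g x \<partial>count_space UNIV) = (\<integral>\<^sup>+ a. \<integral>\<^sup>+ b. g (a, b) \<partial>count_space UNIV \<partial>count_space UNIV)"
      by (rule nn_integral_fst_count_space[symmetric])
    also have "\<dots> = 1" by (simp add: row nn_integral_pmf)
    finally show ?thesis .
  qed
  show pm: "pmf (embed_pmf g) x = g x" for x
    by (rule pmf_embed_pmf) (use nn tot in auto)
  show "map_pmf fst (embed_pmf g) = p"
  proof (rule pmf_eqI)
    fix a
    have "ennreal (pmf (map_pmf fst (embed_pmf g)) a) =
      (\<integral>\<^sup>+ x. ennreal (g x) * indicator (fst -` {a}) x \<partial>count_space UNIV)"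
      by (simp only: ennreal_pmf_map nn_integral_measure_pmf pm)
    also have "\<dots> =
      (\<integral>\<^sup>+ a'. \<integral>\<^sup>+ b. ennreal (g (a', b)) * indicator (fst -` {a}) (a', b) \<partial>count_space UNIV \<partial>count_space UNIV)"
      by (rule nn_integral_fst_count_space[symmetric])
    also have "\<dots> = (\<integral>\<^sup>+ a'. ennreal (pmf p a) * indicator {a} a' \<partial>count_space UNIV)"
      by (intro nn_integral_cong) (auto simp: row split: split_indicator)
    also have "\<dots> = ennreal (pmf p a)"
      by (simp add: nn_integral_cmult_indicator)
    finally show "pmf (map_pmf fst (embed_pmf g)) a = pmf p a" by simp
  qed
  show "map_pmf snd (embed_pmf g) = q"
  proof (rule pmf_eqI)
    fix a
    have "ennreal (pmf (map_pmf snd (embed_pmf g)) a) =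
      (\<integral>\<^sup>+ x. ennreal (g x) * indicator (snd -` {a}) x \<partial>count_space UNIV)"
      by (simp only: ennreal_pmf_map nn_integral_measure_pmf pm)
    also have "\<dots> =
      (\<integral>\<^sup>+ b. \<integral>\<^sup>+ a'. ennreal (g (a', b)) * indicator (snd -` {a}) (a', b) \<partial>count_space UNIV \<partial>count_space UNIV)"
      by (rule nn_integral_snd_count_space[symmetric])
    also have "\<dots> = (\<integral>\<^sup>+ a'. ennreal (pmf q a) * indicator {a} a' \<partial>count_space UNIV)"
      by (intro nn_integral_cong) (auto simp: col split: split_indicator)
    also have "\<dots> = ennreal (pmf q a)"
      by (simp add: nn_integral_cmult_indicator)
    finally show "pmf (map_pmf snd (embed_pmf g)) a = pmf q a" by simp
  qed
qed

text \<open>Holds because the union has probability at most one. It bounds from below what is left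
  of an event inside a set of almost full mass.\<close>

lemma (in prob_space) prob_Int_ge:
  assumes "A \<in> events" "B \<in> events" shows "prob A + prob B - 1 \<le> prob (A \<inter> B)"
  using finite_measure_Union'[of A B] assms prob_le_1[of "A \<union> B"] finite_measure_Diff'[of B A]
    by (auto simp: Int_commute)

text \<open>The support of \<open>q\<close> is countable and nonempty, hence the increasing union of
  the finite images of initial segments of an enumeration.\<close>

lemma finite_set_pmf_approx:
  assumes "0 < \<delta>"
  obtains B where "finite B" "1 - \<delta> < measure (measure_pmf q) B"
proof -
  let ?A = "\<lambda>n. from_nat_into (set_pmf q) ` {..n}"
  have "(\<lambda>n. measure (measure_pmf q) (?A n)) \<longlonglongrightarrow> measure (measure_pmf q) (\<Union>n. ?A n)"
    by (intro measure_pmf.finite_Lim_measure_incseq) (auto simp: incseq_def)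
  also have "(\<Union>n. ?A n) = range (from_nat_into (set_pmf q))" by auto
  also have "\<dots> = set_pmf q"
    by (intro range_from_nat_into) (auto simp: set_pmf_not_empty)
  also have "measure (measure_pmf q) (set_pmf q) = 1"
    by (simp add: measure_pmf.prob_eq_1 AE_measure_pmf)
  finally have "\<forall>\<^sub>F n in sequentially. 1 - \<delta> < measure (measure_pmf q) (?A n)"
    by (rule order_tendstoD) (use assms in simp)
  then obtain n where "1 - \<delta> < measure (measure_pmf q) (?A n)"
    by (auto simp: eventually_sequentially)
  then show ?thesis by (intro that[of "?A n"]) auto
qed

text \<open>The residual marginals \<open>u\<close> and \<open>v\<close> of \<open>h\<close> have
  the same mass \<open>1 - T\<close>. Adding their product divided by \<open>1 - T\<close> restores
  both marginals and never lowers an entry.\<close>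

lemma coupling_completion:
  fixes h :: "'a \<Rightarrow> 'b \<Rightarrow> real"
  assumes fin: "finite A" "finite B" and h0: "\<And>a b. 0 \<le> h a b"
    and off: "\<And>a b. a \<notin> A \<or> b \<notin> B \<Longrightarrow> h a b = 0"
    and row: "\<And>a. (\<Sum>b\<in>B. h a b) \<le> pmf p a" and col: "\<And>b. (\<Sum>a\<in>A. h a b) \<le> pmf q b"
  shows "\<exists>\<mu>. map_pmf fst \<mu> = p \<and> map_pmf snd \<mu> = q \<and> (\<forall>a b. h a b \<le> pmf \<mu> (a, b))"
proof -
  define u where "u a = pmf p a - (\<Sum>b\<in>B. h a b)" for a
  define v where "v b = pmf q b - (\<Sum>a\<in>A. h a b)" for b
  define T where "T = (\<Sum>a\<in>A. \<Sum>b\<in>B. h a b)"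
  have u0: "0 \<le> u a" and v0: "0 \<le> v b" for a b using row col by (auto simp: u_def v_def)
  have fs: "(\<integral>\<^sup>+ x. ennreal (k x) \<partial>count_space UNIV) = ennreal (\<Sum>x\<in>F. k x)"
    if "finite F" "\<And>x. x \<notin> F \<Longrightarrow> k x = 0" "\<And>x. 0 \<le> k x" for F and k :: "'c \<Rightarrow> real"
    using that by (subst nn_integral_count_space'[of F]) auto
  have T0: "0 \<le> T" unfolding T_def by (intro sum_nonneg h0)
  have iu: "(\<integral>\<^sup>+ a. u a \<partial>count_space UNIV) = ennreal (1 - T)"
  proof -
    have "(\<integral>\<^sup>+ a. u a \<partial>count_space UNIV) + ennreal T
      = (\<integral>\<^sup>+ a. u a \<partial>count_space UNIV) + (\<integral>\<^sup>+ a. (\<Sum>b\<in>B. h a b) \<partial>count_space UNIV)"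
      unfolding T_def using fin off by (subst fs[of A]) (auto intro!: sum_nonneg h0)
    also have "\<dots> = (\<integral>\<^sup>+ a. ennreal (u a) + ennreal (\<Sum>b\<in>B. h a b) \<partial>count_space UNIV)"
      by (rule nn_integral_add[symmetric]) auto
    also have "\<dots> = (\<integral>\<^sup>+ a. pmf p a \<partial>count_space UNIV)"
      by (intro nn_integral_cong) (subst ennreal_plus[OF u0 sum_nonneg[OF h0], symmetric], simp add: u_def)
    also have "\<dots> = 1" by (simp add: nn_integral_pmf)
    finally show ?thesis
      by (metis T0 ennreal_1 ennreal_add_diff_cancel_right ennreal_minus ennreal_neq_top infinity_ennreal_def)
  qed
  have T': "T = (\<Sum>b\<in>B. \<Sum>a\<in>A. h a b)" unfolding T_def by (rule sum.swap)
  have iv: "(\<integral>\<^sup>+ b. v b \<partial>count_space UNIV) = ennreal (1 - T)"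
  proof -
    have "(\<integral>\<^sup>+ a. v a \<partial>count_space UNIV) + ennreal T
      = (\<integral>\<^sup>+ a. v a \<partial>count_space UNIV) + (\<integral>\<^sup>+ b. (\<Sum>a\<in>A. h a b) \<partial>count_space UNIV)"
      unfolding T' using fin off by (subst fs[of B]) (auto intro!: sum_nonneg h0)
    also have "\<dots> = (\<integral>\<^sup>+ b. ennreal (v b) + ennreal (\<Sum>a\<in>A. h a b) \<partial>count_space UNIV)"
      by (rule nn_integral_add[symmetric]) auto
    also have "\<dots> = (\<integral>\<^sup>+ a. pmf q a \<partial>count_space UNIV)"
      by (intro nn_integral_cong) (subst ennreal_plus[OF v0 sum_nonneg[OF h0], symmetric], simp add: v_def)
    also have "\<dots> = 1" by (simp add: nn_integral_pmf)
    finally show ?thesis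
      by (metis T0 ennreal_1 ennreal_add_diff_cancel_right ennreal_minus ennreal_neq_top infinity_ennreal_def)
  qed
  have T1: "T \<le> 1"
  proof -
    have "T \<le> (\<Sum>a\<in>A. pmf p a)" unfolding T_def by (intro sum_mono row)
    also have "\<dots> = measure p A" using fin by (simp add: measure_measure_pmf_finite)
    also have "\<dots> \<le> 1" by simp
    finally show ?thesis .
  qed
  \<comment> \<open>If \<open>h\<close> already has full mass, both residuals vanish. The correction
    term is then zero, in agreement with the convention for division by zero.\<close>
  have degen: "u a = 0" "v b = 0" if "T = 1" for a b
  proof -
    have "(\<integral>\<^sup>+ a. u a \<partial>count_space UNIV) = 0" "(\<integral>\<^sup>+ b. v b \<partial>count_space UNIV) = 0"
      using iu iv that by simp_all
    then have "ennreal (u a) = 0" "ennreal (v b) = 0"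
      by (simp_all add: nn_integral_0_iff_AE AE_count_space)
    then show "u a = 0" "v b = 0" using u0[of a] v0[of b] by (auto simp: ennreal_eq_0_iff)
  qed
  define g where "g = (\<lambda>(a, b). h a b + u a * v b / (1 - T))"
  have "0 \<le> g x" for x unfolding g_def using u0 v0 h0 T1 by (auto split: prod.split)
  then have "\<exists>\<mu>. (\<forall>x. pmf \<mu> x = g x) \<and> map_pmf fst \<mu> = p \<and> map_pmf snd \<mu> = q"
  proof (rule pmf_with_marginals)
    fix a
    have "(\<integral>\<^sup>+ b. g (a, b) \<partial>count_space UNIV) =
      (\<integral>\<^sup>+ b. ennreal (h a b) + ennreal (u a / (1 - T)) * ennreal (v b) \<partial>count_space UNIV)"
      using u0 v0 h0 T1 by (intro nn_integral_cong) (simp add: g_def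
        flip: ennreal_plus ennreal_mult)
    also have "\<dots> = ennreal (\<Sum>b\<in>B. h a b) + ennreal (u a / (1 - T)) * ennreal (1 - T)"
      using fin off h0 by (subst nn_integral_add) (auto simp: nn_integral_cmult iv fs[of B])
    also have "\<dots> = ennreal ((\<Sum>b\<in>B. h a b) + u a)"
      using u0 v0 h0 T1 degen(1)[of a] by (cases "T = 1") (auto simp: sum_nonneg simp
        flip: ennreal_plus ennreal_mult)
    finally show "(\<integral>\<^sup>+ b. g (a, b) \<partial>count_space UNIV) = pmf p a" by (simp add: u_def)
  next
    fix b
    have "(\<integral>\<^sup>+ a. g (a, b) \<partial>count_space UNIV) =
      (\<integral>\<^sup>+ a. ennreal (h a b) + ennreal (v b / (1 - T)) * ennreal (u a) \<partial>count_space UNIV)"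
      using u0 v0 h0 T1 by (intro nn_integral_cong) (simp add: g_def mult.commute
        flip: ennreal_plus ennreal_mult)
    also have "\<dots> = ennreal (\<Sum>a\<in>A. h a b) + ennreal (v b / (1 - T)) * ennreal (1 - T)"
      using fin off h0 by (subst nn_integral_add) (auto simp: nn_integral_cmult iu fs[of A])
    also have "\<dots> = ennreal ((\<Sum>a\<in>A. h a b) + v b)"
      using u0 v0 h0 T1 degen(2)[of b] by (cases "T = 1") (auto simp: sum_nonneg simp
        flip: ennreal_plus ennreal_mult)
    finally show "(\<integral>\<^sup>+ a. g (a, b) \<partial>count_space UNIV) = pmf q b" by (simp add: v_def)
  qed
  then obtain \<mu> where \<mu>: "\<And>x. pmf \<mu> x = g x" "map_pmf fst \<mu> = p" "map_pmf snd \<mu> = q"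
    by blast
  moreover have "h a b \<le> pmf \<mu> (a, b)" for a b using u0 v0 T1 by (simp add: \<mu>(1) g_def)
  ultimately show ?thesis by blast
qed

text \<open>Restricting both sides to finite sets costs \<open>\<delta> / 2\<close> each. A flow on
  the finite part, stripped of an extra column that absorbs the deficit, is a partial coupling
  inside \<open>R\<close>, and \<open>coupling_completion\<close> extends it.\<close>

lemma strassen_approx:
  fixes p :: "'a pmf" and q :: "'b pmf"
  assumes hall: "\<And>M. measure (measure_pmf p) M \<le> measure (measure_pmf q) (R `` M) + \<epsilon>" and "0 < \<delta>"
  obtains \<mu> where "map_pmf fst \<mu> = p" "map_pmf snd \<mu> = q" "measure (measure_pmf \<mu>) (- R) \<le> \<epsilon> + \<delta>"
proof -
  have d2: "0 < \<delta> / 2" using assms(2) by simp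
  obtain A where A: "finite A" "1 - \<delta> / 2 < measure (measure_pmf p) A"
    using finite_set_pmf_approx[OF d2] .
  obtain B where B: "finite B" "1 - \<delta> / 2 < measure (measure_pmf q) B"
    using finite_set_pmf_approx[OF d2] .
  have e0: "0 \<le> \<epsilon>" using hall[of "{}"] by simp
  \<comment> \<open>The extra column \<open>None\<close>, related to everything, absorbs the deficit.\<close>
  define B' where "B' = insert None (Some ` B)"
  define R' where "R' = {(a, c). case c of None \<Rightarrow> True | Some b \<Rightarrow> (a, b) \<in> R}"
  define q' where "q' c = (case c of None \<Rightarrow> \<epsilon> + \<delta> / 2 | Some b \<Rightarrow> pmf q b)" for c
  have "\<exists>f. (\<forall>a b. 0 \<le> f a b) \<and> (\<forall>a b. f a b \<noteq> 0 \<longrightarrow> a \<in> A \<and> b \<in> B' \<and> (a, b) \<in> R') \<and>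
    (\<forall>a\<in>A. (\<Sum>b\<in>B'. f a b) = pmf p a) \<and> (\<forall>b\<in>B'. (\<Sum>a\<in>A. f a b) \<le> q' b)"
  proof (rule fractional_hall)
    show "0 \<le> q' b" for b using e0 d2 by (auto simp: q'_def split: option.split)
    \<comment> \<open>The extra column is a neighbour of every nonempty \<open>M\<close> but not of
      the empty set, hence the case distinction.\<close>
    show "sum (pmf p) M \<le> sum q' (B' \<inter> R' `` M)" if M: "M \<subseteq> A" for M
    proof (cases "M = {}")
      case False
      then have "B' \<inter> R' `` M = insert None (Some ` (B \<inter> R `` M))"
        by (auto simp: B'_def R'_def image_iff)
      then have *: "sum q' (B' \<inter> R' `` M) = \<epsilon> + \<delta> / 2 + measure q (B \<inter> R `` M)"
        using B by (simp add: sum.reindex q'_def measure_measure_pmf_finite)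
      have "sum (pmf p) M = measure p M"
        using M A finite_subset by (subst measure_measure_pmf_finite) auto
      also have "\<dots> \<le> measure q (R `` M) + \<epsilon>" by (rule hall)
      also have "measure q (R `` M) \<le> measure q (B \<inter> R `` M) + \<delta> / 2"
        using measure_pmf.prob_Int_ge[of B q "R `` M"] B by simp
      finally show ?thesis using * by simp
    qed simp
  qed (use A B in \<open>auto simp: B'_def\<close>)
  then obtain f where f0: "\<And>a c. 0 \<le> f a c"
    and fR: "\<And>a c. f a c \<noteq> 0 \<Longrightarrow> a \<in> A \<and> c \<in> B' \<and> (a, c) \<in> R'"
    and fp: "\<And>a. a \<in> A \<Longrightarrow> (\<Sum>c\<in>B'. f a c) = pmf p a"
    and fq: "\<And>c. c \<in> B' \<Longrightarrow> (\<Sum>a\<in>A. f a c) \<le> q' c"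
    by blast
  define h where "h a b = f a (Some b)" for a b
  have hR: "h a b \<noteq> 0 \<Longrightarrow> a \<in> A \<and> b \<in> B \<and> (a, b) \<in> R" for a b
    using fR[of a "Some b"] by (auto simp: h_def B'_def R'_def)
  have hsum: "(\<Sum>b\<in>B. h a b) = pmf p a - f a None" if "a \<in> A" for a
    using fp[OF that] B by (simp add: B'_def sum.reindex h_def)
  have "\<exists>\<mu>. map_pmf fst \<mu> = p \<and> map_pmf snd \<mu> = q \<and> (\<forall>a b. h a b \<le> pmf \<mu> (a, b))"
  proof (rule coupling_completion)
    show "(\<Sum>b\<in>B. h a b) \<le> pmf p a" for a
    proof (cases "a \<in> A")
      case True
      then show ?thesis using hsum f0[of a None] by simp
    next
      case False
      then have "h a b = 0" for b using hR by blast
      then show ?thesis by simp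
    qed
    show "(\<Sum>a\<in>A. h a b) \<le> pmf q b" for b
    proof (cases "b \<in> B")
      case True
      then show ?thesis using fq[of "Some b"] by (simp add: B'_def h_def q'_def)
    next
      case False
      then have "h a b = 0" for a using hR by blast
      then show ?thesis by simp
    qed
    show "h a b = 0" if "a \<notin> A \<or> b \<notin> B" for a b using hR that by blast
  qed (use A B f0 in \<open>auto simp: h_def\<close>)
  then obtain \<mu> where \<mu>: "map_pmf fst \<mu> = p" "map_pmf snd \<mu> = q" "\<And>a b. h a b \<le> pmf \<mu> (a, b)"
    by blast
  \<comment> \<open>Mass count: \<open>A\<close> carries more than \<open>1 - \<delta> / 2\<close>,
    at most \<open>\<epsilon> + \<delta> / 2\<close> of it flows to the column \<open>None\<close>,
    and the rest lies on pairs in \<open>R\<close>.\<close>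
  have "1 - \<delta> / 2 - (\<epsilon> + \<delta> / 2) \<le> measure p A - (\<Sum>a\<in>A. f a None)"
    using A fq[of None] by (simp add: B'_def q'_def)
  also have "\<dots> = (\<Sum>a\<in>A. \<Sum>b\<in>B. h a b)"
    using A by (simp add: hsum sum_subtractf measure_measure_pmf_finite)
  also have "\<dots> = (\<Sum>(a, b)\<in>A \<times> B. h a b)" by (rule sum.cartesian_product)
  also have "\<dots> = (\<Sum>(a, b)\<in>A \<times> B \<inter> R. h a b)"
    using A B hR by (intro sum.mono_neutral_right) auto
  also have "\<dots> \<le> (\<Sum>x\<in>A \<times> B \<inter> R. pmf \<mu> x)"
    using \<mu>(3) by (intro sum_mono) auto
  also have "\<dots> = measure \<mu> (A \<times> B \<inter> R)"
    using A B by (subst measure_measure_pmf_finite) auto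
  also have "\<dots> \<le> measure \<mu> R" by (rule measure_pmf.finite_measure_mono) auto
  also have "measure \<mu> R = 1 - measure \<mu> (- R)"
    using measure_pmf.prob_compl[of R \<mu>] by (simp add: Compl_eq_Diff_UNIV)
  finally show ?thesis using \<mu> by (intro that) auto
qed

section \<open>Compactness of couplings\<close>

text \<open>An enumeration of \<open>K\<close> turns the functions into points of a countable power
  of the unit interval. This power is compact by Tychonoff's theorem and metrizable, hence
  sequentially compact. Off \<open>K\<close> all functions are zero.\<close>

lemma pointwise_convergent_subsequence:
  fixes f :: "nat \<Rightarrow> 'k \<Rightarrow> real"
  assumes K: "countable K" and off: "\<And>n x. x \<notin> K \<Longrightarrow> f n x = 0"
    and bnd: "\<And>n x. f n x \<in> {0..1}"
  shows "\<exists>r g. strict_mono r \<and> (\<forall>x. (\<lambda>n. f (r n) x) \<longlonglongrightarrow> g x)"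
proof -
  let ?S = "PiE UNIV (\<lambda>_::nat. {0..1::real})"
  have "compactin (product_topology (\<lambda>_::nat. euclidean) UNIV) ?S"
    by (simp add: compactin_PiE)
  then have "compact ?S" by (simp add: euclidean_product_topology)
  then have "seq_compact ?S" by (simp add: compact_eq_seq_compact_metric)
  moreover have "\<forall>n. (\<lambda>k. f n (from_nat_into K k)) \<in> ?S" using bnd by auto
  ultimately obtain l r where lr: "strict_mono r"
    "((\<lambda>n k. f n (from_nat_into K k)) \<circ> r) \<longlonglongrightarrow> l"
    unfolding seq_compact_def by metis
  have conv: "(\<lambda>n. f (r n) (from_nat_into K k)) \<longlonglongrightarrow> l k" for k
  proof -
    have "continuous_on UNIV (\<lambda>x::nat \<Rightarrow> real. x k)"
      by (rule continuous_on_product_then_coordinatewise) (rule continuous_on_id)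
    then have "isCont (\<lambda>x::nat \<Rightarrow> real. x k) l"
      using continuous_on_eq_continuous_at[OF open_UNIV] by blast
    from isCont_tendsto_compose[OF this lr(2)] show ?thesis by simp
  qed
  have "(\<lambda>n. f (r n) x) \<longlonglongrightarrow> (if x \<in> K then l (to_nat_on K x) else 0)" for x
    using conv[of "to_nat_on K x"] K off by auto
  with lr(1) show ?thesis by (intro exI conjI allI)
qed

text \<open>A finite set carries almost all of \<open>q\<close>, so no mass of row \<open>a\<close> escapes in the limit.\<close>

lemma row_sum_limit:
  fixes \<mu> :: "nat \<Rightarrow> ('a \<times> 'b) pmf"
  assumes g: "\<And>x. (\<lambda>n. pmf (\<mu> n) x) \<longlonglongrightarrow> g x"
    and p: "\<And>a. (\<lambda>n. pmf (map_pmf fst (\<mu> n)) a) \<longlonglongrightarrow> pmf p a"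
    and q: "\<And>b. (\<lambda>n. pmf (map_pmf snd (\<mu> n)) b) \<longlonglongrightarrow> pmf q b"
  shows "(\<integral>\<^sup>+ b. g (a, b) \<partial>count_space UNIV) = pmf p a"
proof (rule antisym)
  have g0: "0 \<le> g x" for x by (rule LIMSEQ_le_const[OF g]) auto
  have pmf_sum: "(\<Sum>b\<in>B. pmf (\<mu> n) (a, b)) = measure (\<mu> n) ({a} \<times> B)" if "finite B" for B n
  proof -
    have "measure (\<mu> n) ({a} \<times> B) = (\<Sum>x\<in>{a} \<times> B. pmf (\<mu> n) x)"
      using that by (intro measure_measure_pmf_finite) auto
    also have "\<dots> = (\<Sum>b\<in>B. pmf (\<mu> n) (a, b))"
      by (rule sum.reindex_cong[of "Pair a"]) (auto simp: inj_on_def)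
    finally show ?thesis ..
  qed
  have lim: "(\<lambda>n. \<Sum>b\<in>B. pmf (\<mu> n) (a, b)) \<longlonglongrightarrow> (\<Sum>b\<in>B. g (a, b))" for B
    by (intro tendsto_sum g)
  \<comment> \<open>Upper bound by Fatou's lemma: mass may be lost in the limit but not
    created.\<close>
  have "(\<integral>\<^sup>+ b. g (a, b) \<partial>count_space UNIV) =
    (\<integral>\<^sup>+ b. liminf (\<lambda>n. ennreal (pmf (\<mu> n) (a, b))) \<partial>count_space UNIV)"
    by (intro nn_integral_cong lim_imp_Liminf[symmetric] tendsto_ennrealI g) simp
  also have "\<dots> \<le> liminf (\<lambda>n. \<integral>\<^sup>+ b. ennreal (pmf (\<mu> n) (a, b)) \<partial>count_space UNIV)"
    by (rule nn_integral_liminf) simp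
  also have "(\<lambda>n. \<integral>\<^sup>+ b. ennreal (pmf (\<mu> n) (a, b)) \<partial>count_space UNIV) =
    (\<lambda>n. ennreal (pmf (map_pmf fst (\<mu> n)) a))"
  proof
    fix n
    have "(\<integral>\<^sup>+ b. ennreal (pmf (\<mu> n) (a, b)) \<partial>count_space UNIV) = emeasure (\<mu> n) (range (Pair a))"
      by (rule nn_integral_pmf') (simp add: inj_on_def)
    also have "range (Pair a) = fst -` {a}" by auto
    finally show "(\<integral>\<^sup>+ b. ennreal (pmf (\<mu> n) (a, b)) \<partial>count_space UNIV) = ennreal (pmf (map_pmf fst (\<mu> n)) a)"
      by (simp add: pmf_map measure_pmf.emeasure_eq_measure)
  qed
  also have "liminf \<dots> = ennreal (pmf p a)"
    by (intro lim_imp_Liminf tendsto_ennrealI p) simp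
  finally show "(\<integral>\<^sup>+ b. g (a, b) \<partial>count_space UNIV) \<le> pmf p a" .
  show "pmf p a \<le> (\<integral>\<^sup>+ b. g (a, b) \<partial>count_space UNIV)"
  proof (rule ennreal_le_epsilon)
    fix \<delta> :: real assume "0 < \<delta>"
    then obtain B where B: "finite B" "1 - \<delta> < measure (measure_pmf q) B"
      by (rule finite_set_pmf_approx)
    \<comment> \<open>The part of row \<open>a\<close> inside \<open>B\<close> is at least the sum
      of the two marginal masses minus one. As \<open>B\<close> is finite, this survives the limit,
      and \<open>B\<close> misses less than \<open>\<delta>\<close> of \<open>q\<close>.\<close>
    have "(\<lambda>n. pmf (map_pmf fst (\<mu> n)) a + (\<Sum>b\<in>B. pmf (map_pmf snd (\<mu> n)) b) - 1)
      \<longlonglongrightarrow> pmf p a + (\<Sum>b\<in>B. pmf q b) - 1"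
      by (intro tendsto_intros p q)
    then have "pmf p a + (\<Sum>b\<in>B. pmf q b) - 1 \<le> (\<Sum>b\<in>B. g (a, b))"
    proof (rule LIMSEQ_le[OF _ lim], intro exI allI impI)
      fix n
      have "measure (\<mu> n) (fst -` {a}) + measure (\<mu> n) (snd -` B) - 1 \<le> measure (\<mu> n) (fst -` {a} \<inter> snd -` B)"
        by (rule measure_pmf.prob_Int_ge) auto
      also have "fst -` {a} \<inter> snd -` B = {a} \<times> B" by auto
      also have "measure (\<mu> n) (snd -` B) = (\<Sum>b\<in>B. pmf (map_pmf snd (\<mu> n)) b)"
        using B by (simp add: measure_measure_pmf_finite[symmetric])
      finally show "pmf (map_pmf fst (\<mu> n)) a + (\<Sum>b\<in>B. pmf (map_pmf snd (\<mu> n)) b) - 1 \<le> (\<Sum>b\<in>B. pmf (\<mu> n) (a, b))"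
        using B by (simp add: pmf_map pmf_sum)
    qed
    moreover have "measure (measure_pmf q) B = (\<Sum>b\<in>B. pmf q b)"
      using B by (simp add: measure_measure_pmf_finite)
    ultimately have "pmf p a \<le> (\<Sum>b\<in>B. g (a, b)) + \<delta>" using B by simp
    then have "ennreal (pmf p a) \<le> ennreal (\<Sum>b\<in>B. g (a, b)) + ennreal \<delta>"
      using \<open>0 < \<delta>\<close> g0 by (simp add: sum_nonneg flip: ennreal_plus)
    also have "ennreal (\<Sum>b\<in>B. g (a, b)) \<le> (\<integral>\<^sup>+ b. g (a, b) \<partial>count_space UNIV)"
    proof -
      have "ennreal (\<Sum>b\<in>B. g (a, b)) = (\<integral>\<^sup>+ b. g (a, b) \<partial>count_space B)"
        using B g0 by (simp add: nn_integral_count_space_finite)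
      also have "\<dots> \<le> (\<integral>\<^sup>+ b. g (a, b) \<partial>count_space UNIV)"
        by (auto simp: nn_integral_count_space_indicator split: split_indicator intro!: nn_integral_mono)
      finally show ?thesis .
    qed
    finally show "ennreal (pmf p a) \<le> (\<integral>\<^sup>+ b. g (a, b) \<partial>count_space UNIV) + ennreal \<delta>"
      by (simp add: add_right_mono)
  qed
qed

text \<open>Compactness and lower semicontinuity at once: couplings within
  \<open>inverse (real (Suc n))\<close> of the bound have a pointwise convergent subsequence. By
  \<open>row_sum_limit\<close> its limit couples \<open>e1\<close> and \<open>e2\<close>, and
  Fatou's lemma bounds the cost of the limit.\<close>

lemma star_inf_limit:
  fixes d1 :: "nat \<Rightarrow> 'a spmf" and d2 :: "nat \<Rightarrow> 'b spmf"
  assumes d1: "\<And>x. (\<lambda>n. pmf (d1 n) x) \<longlonglongrightarrow> pmf e1 x"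
    and d2: "\<And>x. (\<lambda>n. pmf (d2 n) x) \<longlonglongrightarrow> pmf e2 x"
    and le: "\<And>n. star_inf (d1 n) (d2 n) \<psi> \<le> c"
  obtains \<mu> where "\<mu> \<in> star_couplings e1 e2" "(\<integral>\<^sup>+ x. star_ext \<psi> x \<partial>measure_pmf \<mu>) \<le> c"
proof (cases "c = \<infinity>")
  \<comment> \<open>With an infinite bound any coupling will do. Only for finite \<open>c\<close> is
    \<open>c + ennreal (inverse (real (Suc n)))\<close> strictly above \<open>c\<close>.\<close>
  case True
  then show ?thesis
    by (intro that[of "pair_pmf e1 e2"]) (auto simp: star_couplings_def map_fst_pair_pmf map_snd_pair_pmf)
next
  case False
  let ?f = "star_ext \<psi>"
  have "\<exists>\<mu>. map_pmf fst \<mu> = d1 n \<and> map_pmf snd \<mu> = d2 n \<and>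
    (\<integral>\<^sup>+ x. ?f x \<partial>measure_pmf \<mu>) \<le> c + ennreal (inverse (real (Suc n)))" for n
  proof -
    have "c + 0 < c + ennreal (inverse (real (Suc n)))"
      unfolding ennreal_add_left_cancel_less using False by (simp add: ennreal_less_zero_iff)
    then have "star_inf (d1 n) (d2 n) \<psi> < c + ennreal (inverse (real (Suc n)))"
      using le[of n] by (simp only: add_0_right order_le_less_trans)
    then show ?thesis
      unfolding star_inf_def by (auto simp: INF_less_iff star_couplings_def intro: less_imp_le)
  qed
  then obtain \<mu> where \<mu>: "\<And>n. map_pmf fst (\<mu> n) = d1 n" "\<And>n. map_pmf snd (\<mu> n) = d2 n"
    "\<And>n. (\<integral>\<^sup>+ x. ?f x \<partial>measure_pmf (\<mu> n)) \<le> c + ennreal (inverse (real (Suc n)))"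
    by metis
  have "countable (\<Union>n. set_pmf (\<mu> n))" by simp
  moreover have "pmf (\<mu> n) x = 0" if "x \<notin> (\<Union>n. set_pmf (\<mu> n))" for n x
    using that by (auto simp: set_pmf_iff)
  moreover have "pmf (\<mu> n) x \<in> {0..1}" for n x by (simp add: pmf_le_1)
  ultimately have "\<exists>r g. strict_mono r \<and> (\<forall>x. (\<lambda>n. pmf (\<mu> (r n)) x) \<longlonglongrightarrow> g x)"
    by (rule pointwise_convergent_subsequence)
  then obtain r g where r: "strict_mono r" and g: "\<And>x. (\<lambda>n. pmf (\<mu> (r n)) x) \<longlonglongrightarrow> g x"
    by blast
  have g0: "0 \<le> g x" for x by (rule LIMSEQ_le_const[OF g]) auto
  have r1: "(\<lambda>n. pmf (d1 (r n)) x) \<longlonglongrightarrow> pmf e1 x" for x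
    using LIMSEQ_subseq_LIMSEQ[OF d1 r] by (simp add: o_def)
  have r2: "(\<lambda>n. pmf (d2 (r n)) x) \<longlonglongrightarrow> pmf e2 x" for x
    using LIMSEQ_subseq_LIMSEQ[OF d2 r] by (simp add: o_def)
  \<comment> \<open>The column sums of the limit are obtained as row sums of the swapped
    couplings.\<close>
  have swap: "pmf (map_pmf prod.swap (\<mu> n)) (b, a) = pmf (\<mu> n) (a, b)" for n a b
    using pmf_map_inj'[of prod.swap "\<mu> n" "(a, b)"] by simp
  have "\<exists>\<nu>. (\<forall>x. pmf \<nu> x = g x) \<and> map_pmf fst \<nu> = e1 \<and> map_pmf snd \<nu> = e2"
  proof (rule pmf_with_marginals[OF g0])
    show "(\<integral>\<^sup>+ b. g (a, b) \<partial>count_space UNIV) = pmf e1 a" for a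
      by (rule row_sum_limit[of "\<lambda>n. \<mu> (r n)" g _ e2]) (simp_all add: \<mu> g r1 r2)
    show "(\<integral>\<^sup>+ a. g (a, b) \<partial>count_space UNIV) = pmf e2 b" for b
      using row_sum_limit[of "\<lambda>n. map_pmf prod.swap (\<mu> (r n))" "\<lambda>(b, a). g (a, b)" e2 e1 b]
      by (auto simp: swap g r1 r2 pmf.map_comp o_def \<mu>)
  qed
  then obtain \<nu> where \<nu>: "\<And>x. pmf \<nu> x = g x" "map_pmf fst \<nu> = e1" "map_pmf snd \<nu> = e2"
    by blast
  have "(\<integral>\<^sup>+ x. ?f x \<partial>measure_pmf \<nu>) = (\<integral>\<^sup>+ x. ennreal (g x) * ?f x \<partial>count_space UNIV)"
    by (simp add: nn_integral_measure_pmf \<nu>)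
  also have "\<dots> \<le> (\<integral>\<^sup>+ x. liminf (\<lambda>n. ennreal (pmf (\<mu> (r n)) x) * ?f x) \<partial>count_space UNIV)"
  proof (rule nn_integral_mono)
    fix x
    show "ennreal (g x) * ?f x \<le> liminf (\<lambda>n. ennreal (pmf (\<mu> (r n)) x) * ?f x)"
    \<comment> \<open>The cost may be infinite, and multiplication is not continuous at zero times
      infinity, so points of limit mass zero are treated separately.\<close>
    proof (cases "g x = 0")
      case False
      have "(\<lambda>n. ennreal (pmf (\<mu> (r n)) x) * ?f x) \<longlonglongrightarrow> ennreal (g x) * ?f x"
        using False g0[of x] by (intro tendsto_mult_ennreal tendsto_ennrealI g tendsto_const) auto
      then show ?thesis by (simp add: lim_imp_Liminf)
    qed simp
  qed
  also have "\<dots> \<le> liminf (\<lambda>n. \<integral>\<^sup>+ x. ennreal (pmf (\<mu> (r n)) x) * ?f x \<partial>count_space UNIV)"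
    by (rule nn_integral_liminf) simp
  also have "\<dots> \<le> liminf (\<lambda>n. c + ennreal (inverse (real (Suc n))))"
  proof (intro Liminf_mono always_eventually allI)
    fix n
    have "(\<integral>\<^sup>+ x. ennreal (pmf (\<mu> (r n)) x) * ?f x \<partial>count_space UNIV)
      \<le> c + ennreal (inverse (real (Suc (r n))))"
      using \<mu>(3)[of "r n"] by (simp add: nn_integral_measure_pmf)
    also have "\<dots> \<le> c + ennreal (inverse (real (Suc n)))"
      using seq_suble[OF r, of n] by (intro add_left_mono ennreal_leI le_imp_inverse_le) auto
    finally show "(\<integral>\<^sup>+ x. ennreal (pmf (\<mu> (r n)) x) * ?f x \<partial>count_space UNIV)
      \<le> c + ennreal (inverse (real (Suc n)))" .
  qed
  also have "\<dots> = c"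
  proof (rule lim_imp_Liminf)
    have "(\<lambda>n. c + ennreal (inverse (real (Suc n)))) \<longlonglongrightarrow> c + ennreal 0"
      by (intro tendsto_add tendsto_const tendsto_ennrealI LIMSEQ_inverse_real_of_nat)
    then show "(\<lambda>n. c + ennreal (inverse (real (Suc n)))) \<longlonglongrightarrow> c" by simp
  qed simp
  finally show ?thesis using \<nu> by (intro that[of \<nu>]) (auto simp: star_couplings_def)
qed

text \<open>Apply the limit lemma to constant sequences: the infimum in \<open>star_inf\<close> is a
  minimum.\<close>

lemma star_inf_attained:
  assumes "star_inf d1 d2 \<psi> \<le> c"
  obtains \<mu> where "\<mu> \<in> star_couplings d1 d2" "(\<integral>\<^sup>+ x. star_ext \<psi> x \<partial>measure_pmf \<mu>) \<le> c"
  using star_inf_limit[OF tendsto_const tendsto_const assms] .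

text \<open>Lets a bound on all finite unrollings of a loop pass to the loop itself.\<close>

lemma star_inf_le_limit:
  assumes "\<And>x. (\<lambda>n. pmf (d1 n) x) \<longlonglongrightarrow> pmf e1 x" "\<And>x. (\<lambda>n. pmf (d2 n) x) \<longlonglongrightarrow> pmf e2 x"
    and "\<And>n. star_inf (d1 n) (d2 n) \<psi> \<le> c"
  shows "star_inf e1 e2 \<psi> \<le> c"
proof -
  obtain \<mu> where "\<mu> \<in> star_couplings e1 e2" "(\<integral>\<^sup>+ x. star_ext \<psi> x \<partial>measure_pmf \<mu>) \<le> c"
    using assms by (rule star_inf_limit)
  then show ?thesis unfolding star_inf_def by (rule INF_lower2)
qed

section \<open>Expectations over sub-distributions\<close>

lemma guard_True: "P a \<Longrightarrow> (P \<triangleright> \<phi>) a = \<phi> a"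
  by (simp add: guard_def)

lemma nn_integral_measure_spmf_option:
  "(\<integral>\<^sup>+ x. f x \<partial>measure_spmf p) = (\<integral>\<^sup>+ x. (case x of None \<Rightarrow> 0 | Some a \<Rightarrow> f a) \<partial>measure_pmf p)"
  by (subst nn_integral_measure_spmf_conv_measure_pmf)
    (auto simp: nn_integral_restrict_space intro!: nn_integral_cong split: option.split split_indicator)

lemma nn_integral_bind_spmf:
  "(\<integral>\<^sup>+ x. f x \<partial>measure_spmf (bind_spmf p g)) = (\<integral>\<^sup>+ a. \<integral>\<^sup>+ x. f x \<partial>measure_spmf (g a) \<partial>measure_spmf p)"
  by (auto simp: nn_integral_measure_spmf_option bind_spmf_def intro!: nn_integral_cong split: option.split)

lemma nn_integral_return_spmf: "(\<integral>\<^sup>+ x. f x \<partial>measure_spmf (return_spmf a)) = f a"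
  by (simp add: nn_integral_measure_spmf_option)

text \<open>Star-couplings read a sub-distribution as a full distribution on the option type, so
  convergence at \<open>None\<close> is included. There the sequence decreases instead of
  increasing, and its limit is read off from the weight.\<close>

lemma pmf_lub_spmf_tendsto:
  assumes mono: "\<And>i j. i \<le> j \<Longrightarrow> ord_spmf (=) (d i) (d j)"
  shows "(\<lambda>n. pmf (d n) x) \<longlonglongrightarrow> pmf (lub_spmf (range d)) x"
proof -
  have ch: "Complete_Partial_Order.chain (ord_spmf (=)) (range d)"
    using mono by (auto intro!: chainI) (metis nat_le_linear)
  show ?thesis
  proof (cases x)
    case None
    have "(\<lambda>n. weight_spmf (d n)) \<longlonglongrightarrow> (SUP n. weight_spmf (d n))"
    proof (rule LIMSEQ_incseq_SUP)
      show "bdd_above (range (\<lambda>n. weight_spmf (d n)))"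
        by (auto intro!: bdd_aboveI2 weight_spmf_le_1)
      show "incseq (\<lambda>n. weight_spmf (d n))"
        using ord_spmf_eqD_emeasure[OF mono, of _ _ UNIV]
        by (auto simp: incseq_def measure_spmf.emeasure_eq_measure space_measure_spmf)
    qed
    also have "(SUP n. weight_spmf (d n)) = weight_spmf (lub_spmf (range d))"
      using ch by (simp add: weight_lub_spmf image_comp)
    finally show ?thesis unfolding None pmf_None_eq_weight_spmf by (intro tendsto_intros)
  next
    case (Some a)
    have "(\<lambda>n. spmf (d n) a) \<longlonglongrightarrow> (SUP n. spmf (d n) a)"
    proof (rule LIMSEQ_incseq_SUP)
      show "bdd_above (range (\<lambda>n. spmf (d n) a))" by (auto intro!: bdd_aboveI2 pmf_le_1)
      show "incseq (\<lambda>n. spmf (d n) a)"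
        by (auto simp: incseq_def intro!: ord_spmf_eq_leD mono)
    qed
    then show ?thesis using ch Some by (simp add: spmf_lub_spmf image_comp)
  qed
qed

lemma nn_integral_lub_spmf:
  fixes d :: "nat \<Rightarrow> 'a spmf"
  assumes mono: "\<And>i j. i \<le> j \<Longrightarrow> ord_spmf (=) (d i) (d j)"
  shows "(\<integral>\<^sup>+ x. f x \<partial>measure_spmf (lub_spmf (range d))) = (SUP n. \<integral>\<^sup>+ x. f x \<partial>measure_spmf (d n))"
proof -
  let ?l = "lub_spmf (range d)"
  have "(SUP n. ennreal (spmf (d n) x)) = ennreal (spmf ?l x)" for x
  proof (rule LIMSEQ_unique)
    show "(\<lambda>n. ennreal (spmf (d n) x)) \<longlonglongrightarrow> (SUP n. ennreal (spmf (d n) x))"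
      by (rule LIMSEQ_SUP) (auto simp: incseq_def intro!: ennreal_leI ord_spmf_eq_leD mono)
    show "(\<lambda>n. ennreal (spmf (d n) x)) \<longlonglongrightarrow> ennreal (spmf ?l x)"
      by (intro tendsto_ennrealI pmf_lub_spmf_tendsto mono)
  qed
  then have "(\<integral>\<^sup>+ x. f x \<partial>measure_spmf ?l) = (\<integral>\<^sup>+ x. (SUP n. ennreal (spmf (d n) x) * f x) \<partial>count_space UNIV)"
    by (simp add: nn_integral_measure_spmf SUP_mult_right_ennreal[symmetric])
  also have "\<dots> = (SUP n. \<integral>\<^sup>+ x. ennreal (spmf (d n) x) * f x \<partial>count_space UNIV)"
    by (rule nn_integral_monotone_convergence_SUP)
      (auto simp: incseq_def le_fun_def intro!: mult_right_mono ennreal_leI ord_spmf_eq_leD mono)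
  finally show ?thesis by (simp add: nn_integral_measure_spmf)
qed

section \<open>Calculus of optimal couplings\<close>

lemma star_inf_le:
  "map_pmf fst \<mu> = d1 \<Longrightarrow> map_pmf snd \<mu> = d2 \<Longrightarrow>
    star_inf d1 d2 \<psi> \<le> (\<integral>\<^sup>+ x. star_ext \<psi> x \<partial>measure_pmf \<mu>)"
  unfolding star_inf_def by (rule INF_lower) (simp add: star_couplings_def)

text \<open>A coupling lives on the product of the supports of its marginals, and
  \<open>star_ext\<close> vanishes as soon as a component is \<open>None\<close>.\<close>

lemma star_inf_mono:
  assumes "\<And>a b. a \<in> set_spmf d1 \<Longrightarrow> b \<in> set_spmf d2 \<Longrightarrow> \<psi> (a, b) \<le> \<psi>' (a, b)"
  shows "star_inf d1 d2 \<psi> \<le> star_inf d1 d2 \<psi>'"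
  unfolding star_inf_def
proof (rule INF_mono)
  fix \<mu> assume \<mu>: "\<mu> \<in> star_couplings d1 d2"
  have "(\<integral>\<^sup>+ x. star_ext \<psi> x \<partial>\<mu>) \<le> (\<integral>\<^sup>+ x. star_ext \<psi>' x \<partial>\<mu>)"
  proof (rule nn_integral_mono_AE, unfold AE_measure_pmf_iff, rule ballI)
    fix x assume x: "x \<in> set_pmf \<mu>"
    have "fst x \<in> set_pmf d1" "snd x \<in> set_pmf d2" using \<mu> x by (auto simp: star_couplings_def)
    then show "star_ext \<psi> x \<le> star_ext \<psi>' x"
      using assms by (cases "(\<psi>, x)" rule: star_ext.cases) (auto simp: in_set_spmf)
  qed
  with \<mu> show "\<exists>\<nu>\<in>star_couplings d1 d2. (\<integral>\<^sup>+ x. star_ext \<psi> x \<partial>\<nu>) \<le> (\<integral>\<^sup>+ x. star_ext \<psi>' x \<partial>\<mu>)"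
    by blast
qed

text \<open>The missing mass of \<open>\<mu>\<close> is placed at \<open>(None, None)\<close>, where
  \<open>star_ext\<close> is zero.\<close>

lemma star_inf_le_coupling:
  assumes "is_coupling \<mu> d1 d2"
  shows "star_inf d1 d2 \<psi> \<le> (\<integral>\<^sup>+ x. \<psi> x \<partial>measure_spmf \<mu>)"
proof -
  let ?\<nu> = "map_pmf (\<lambda>x. (map_option fst x, map_option snd x)) \<mu>"
  have "star_inf d1 d2 \<psi> \<le> (\<integral>\<^sup>+ x. star_ext \<psi> x \<partial>measure_pmf ?\<nu>)"
    using assms by (intro star_inf_le) (auto simp: is_coupling_def pmf.map_comp o_def)
  also have "\<dots> = (\<integral>\<^sup>+ x. \<psi> x \<partial>measure_spmf \<mu>)"
    by (auto simp: nn_integral_measure_spmf_option intro!: nn_integral_cong split: option.split)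
  finally show ?thesis .
qed

lemma star_inf_return: "star_inf (return_spmf a) (return_spmf b) \<psi> \<le> \<psi> (a, b)"
  using star_inf_le[of "return_pmf (Some a, Some b)" "return_spmf a" "return_spmf b" \<psi>] by simp

text \<open>Every pair has \<open>None\<close> as a component, so nothing is charged. This is the
  base case for unrolling loops.\<close>

lemma star_inf_None_left: "star_inf (return_pmf None) d \<psi> = 0"
  using star_inf_le[of "map_pmf (\<lambda>x. (None, x)) d" "return_pmf None" d \<psi>]
  by (simp add: pmf.map_comp o_def)

lemma star_inf_None_right: "star_inf d (return_pmf None) \<psi> = 0"
  using star_inf_le[of "map_pmf (\<lambda>x. (x, None)) d" d "return_pmf None" \<psi>]
  by (simp add: pmf.map_comp o_def)

text \<open>Optimal couplings of the continuations, available because minima are attained, are glued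
  along a coupling of the first stages.\<close>

lemma star_inf_bind:
  "star_inf (bind_spmf d1 f) (bind_spmf d2 g) \<psi> \<le> star_inf d1 d2 (\<lambda>(a, b). star_inf (f a) (g b) \<psi>)"
proof -
  have "\<exists>\<kappa>. map_pmf fst \<kappa> = f a \<and> map_pmf snd \<kappa> = g b \<and>
    (\<integral>\<^sup>+ x. star_ext \<psi> x \<partial>measure_pmf \<kappa>) \<le> star_inf (f a) (g b) \<psi>" for a b
    by (rule star_inf_attained[OF order_refl, of "f a" "g b" \<psi>]) (auto simp: star_couplings_def)
  then obtain \<kappa> where \<kappa>: "\<And>a b. map_pmf fst (\<kappa> a b) = f a" "\<And>a b. map_pmf snd (\<kappa> a b) = g b"
    "\<And>a b. (\<integral>\<^sup>+ x. star_ext \<psi> x \<partial>measure_pmf (\<kappa> a b)) \<le> star_inf (f a) (g b) \<psi>" by metis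
  \<comment> \<open>A side that has already lost its mass stays at \<open>None\<close> and is paired
    with whatever the other side still does, at no cost.\<close>
  define K where "K x = (case x of (Some a, Some b) \<Rightarrow> \<kappa> a b | (Some a, None) \<Rightarrow> map_pmf (\<lambda>y. (y, None)) (f a)
    | (None, Some b) \<Rightarrow> map_pmf (\<lambda>y. (None, y)) (g b) | (None, None) \<Rightarrow> return_pmf (None, None))" for x
  have K1: "map_pmf fst (K x) = (case fst x of None \<Rightarrow> return_pmf None | Some a \<Rightarrow> f a)" for x
    by (auto simp: K_def \<kappa> pmf.map_comp o_def split: prod.split option.split)
  have K2: "map_pmf snd (K x) = (case snd x of None \<Rightarrow> return_pmf None | Some b \<Rightarrow> g b)" for x
    by (auto simp: K_def \<kappa> pmf.map_comp o_def split: prod.split option.split)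
  have K3: "(\<integral>\<^sup>+ y. star_ext \<psi> y \<partial>measure_pmf (K x)) \<le> star_ext (\<lambda>(a, b). star_inf (f a) (g b) \<psi>) x"
    for x
    by (auto simp: K_def \<kappa> split: prod.split option.split)
  show ?thesis
    unfolding star_inf_def[of d1 d2]
  proof (rule INF_greatest)
    fix \<mu> assume "\<mu> \<in> star_couplings d1 d2"
    then have \<mu>: "map_pmf fst \<mu> = d1" "map_pmf snd \<mu> = d2" by (auto simp: star_couplings_def)
    have "star_inf (bind_spmf d1 f) (bind_spmf d2 g) \<psi> \<le> (\<integral>\<^sup>+ y. star_ext \<psi> y \<partial>measure_pmf (bind_pmf \<mu> K))"
      by (rule star_inf_le) (simp_all add: map_bind_pmf K1 K2 bind_spmf_def bind_map_pmf flip: \<mu>)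
    also have "\<dots> \<le> (\<integral>\<^sup>+ x. star_ext (\<lambda>(a, b). star_inf (f a) (g b) \<psi>) x \<partial>measure_pmf \<mu>)"
      by (simp add: K3 nn_integral_mono)
    finally show "star_inf (bind_spmf d1 f) (bind_spmf d2 g) \<psi> \<le> \<dots>" .
  qed
qed

lemma star_inf_bind_le:
  assumes "\<And>a b. a \<in> set_spmf d1 \<Longrightarrow> b \<in> set_spmf d2 \<Longrightarrow> star_inf (f a) (g b) \<psi> \<le> \<theta> (a, b)"
    and "star_inf d1 d2 \<theta> \<le> c"
  shows "star_inf (bind_spmf d1 f) (bind_spmf d2 g) \<psi> \<le> c"
proof -
  note star_inf_bind
  also have "star_inf d1 d2 (\<lambda>(a, b). star_inf (f a) (g b) \<psi>) \<le> star_inf d1 d2 \<theta>"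
    using assms(1) by (intro star_inf_mono) auto
  also note assms(2)
  finally show ?thesis .
qed

text \<open>For lossless marginals every coupling gives the assertion about \<open>M\<close> the
  same expectation: the \<open>d1\<close>-mass of \<open>M\<close> plus the \<open>d2\<close>-mass
  outside the image of \<open>M\<close> under \<open>R\<close>. For finite \<open>c\<close> the
  hypothesis is therefore Hall's condition with deficit \<open>c\<close>.\<close>

lemma star_inf_strassen:
  fixes d1 :: "'a spmf" and d2 :: "'b spmf"
  assumes ll: "lossless_spmf d1" "lossless_spmf d2"
    and M: "\<And>M. star_inf d1 d2 (\<lambda>(a, b). of_bool (a \<in> M) + of_bool (b \<notin> R `` M)) \<le> 1 + c"
  shows "star_inf d1 d2 (\<lambda>(a, b). of_bool ((a, b) \<notin> R)) \<le> c"
proof (rule ennreal_le_epsilon)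
  fix \<delta> :: real assume "c < \<top>" and \<delta>: "0 < \<delta>"
  then obtain \<epsilon> where c: "c = ennreal \<epsilon>" "0 \<le> \<epsilon>" by (cases c) auto
  \<comment> \<open>The relation is lifted to options with \<open>None\<close> unrelated to
    anything; losslessness keeps \<open>None\<close> out of both supports.\<close>
  define R' where "R' = {(Some a, Some b) | a b. (a, b) \<in> R}"
  have None: "None \<notin> set_pmf d1" "None \<notin> set_pmf d2" using ll
    by (auto simp: lossless_iff_set_pmf_None)
  have "measure d1 M' \<le> measure d2 (R' `` M') + \<epsilon>" for M'
  proof -
    define N where "N = {a. Some a \<in> M'}"
    have RN: "Some b \<in> R' `` M' \<longleftrightarrow> b \<in> R `` N" for b by (auto simp: R'_def N_def)
    obtain \<mu> where "\<mu> \<in> star_couplings d1 d2"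
      and le: "(\<integral>\<^sup>+ x. star_ext (\<lambda>(a, b). of_bool (a \<in> N) + of_bool (b \<notin> R `` N)) x \<partial>measure_pmf \<mu>) \<le> 1 + c"
      using star_inf_attained[OF M] .
    then have \<mu>: "map_pmf fst \<mu> = d1" "map_pmf snd \<mu> = d2" by (auto simp: star_couplings_def)
    \<comment> \<open>This sum involves only the marginals, so it can be evaluated under the
      coupling that meets the bound.\<close>
    have "emeasure d1 M' + emeasure d2 (- (R' `` M')) =
      (\<integral>\<^sup>+ x. indicator (fst -` M') x + indicator (snd -` (- (R' `` M'))) x \<partial>measure_pmf \<mu>)"
      by (subst nn_integral_add) (simp_all flip: \<mu>)
    also have "\<dots> = (\<integral>\<^sup>+ x. star_ext (\<lambda>(a, b). of_bool (a \<in> N) + of_bool (b \<notin> R `` N)) x \<partial>measure_pmf \<mu>)"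
    proof (rule nn_integral_cong_AE, unfold AE_measure_pmf_iff, rule ballI)
      fix x assume "x \<in> set_pmf \<mu>"
      then have "fst x \<in> set_pmf d1" "snd x \<in> set_pmf d2" by (auto simp flip: \<mu>)
      then obtain a b where x: "x = (Some a, Some b)" using None
        by (cases x; cases "fst x"; cases "snd x") auto
      show "indicator (fst -` M') x + indicator (snd -` (- (R' `` M'))) x =
        star_ext (\<lambda>(a, b). of_bool (a \<in> N) + of_bool (b \<notin> R `` N)) x"
        using RN[of b] by (auto simp: x N_def indicator_def)
    qed
    also have "\<dots> \<le> 1 + c" by (rule le)
    finally have "ennreal (measure d1 M' + measure d2 (- (R' `` M'))) \<le> ennreal (1 + \<epsilon>)"
      using c by (simp add: measure_pmf.emeasure_eq_measure)
    then have "measure d1 M' + measure d2 (- (R' `` M')) \<le> 1 + \<epsilon>"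
      using c by (subst (asm) ennreal_le_iff) auto
    then show ?thesis
      using measure_pmf.prob_compl[of "R' `` M'" d2] by (simp add: Compl_eq_Diff_UNIV)
  qed
  from strassen_approx[OF this \<delta>] obtain \<mu>
    where \<mu>: "map_pmf fst \<mu> = d1" "map_pmf snd \<mu> = d2" "measure (measure_pmf \<mu>) (- R') \<le> \<epsilon> + \<delta>" .
  have "star_inf d1 d2 (\<lambda>(a, b). of_bool ((a, b) \<notin> R)) \<le>
    (\<integral>\<^sup>+ x. star_ext (\<lambda>(a, b). of_bool ((a, b) \<notin> R)) x \<partial>measure_pmf \<mu>)"
    using \<mu> by (intro star_inf_le)
  also have "\<dots> \<le> (\<integral>\<^sup>+ x. indicator (- R') x \<partial>measure_pmf \<mu>)"
  proof (rule nn_integral_mono)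
    fix x
    show "star_ext (\<lambda>(a, b). of_bool ((a, b) \<notin> R)) x \<le> indicator (- R') x"
      by (cases x; cases "fst x"; cases "snd x") (auto simp: R'_def)
  qed
  also have "\<dots> = ennreal (measure \<mu> (- R'))" by (simp add: measure_pmf.emeasure_eq_measure)
  also have "\<dots> \<le> ennreal (\<epsilon> + \<delta>)" using \<mu> by (intro ennreal_leI)
  also have "\<dots> = c + ennreal \<delta>" using c \<delta> by simp
  finally show "star_inf d1 d2 (\<lambda>(a, b). of_bool ((a, b) \<notin> R)) \<le> c + ennreal \<delta>" .
qed

text \<open>An attained cost of zero makes the cost vanish on the whole support of the coupling.
  Losslessness excludes \<open>None\<close> there, so both components can be unwrapped.\<close>

lemma coupling_of_star_inf_zero:
  assumes ll: "lossless_spmf d1" "lossless_spmf d2"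
    and le: "star_inf d1 d2 (\<lambda>(a, b). of_bool ((a, b) \<notin> S)) \<le> 0"
  shows "\<exists>\<mu>. is_coupling \<mu> d1 d2 \<and> set_spmf \<mu> \<subseteq> S"
proof -
  have None: "None \<notin> set_pmf d1" "None \<notin> set_pmf d2" using ll
    by (auto simp: lossless_iff_set_pmf_None)
  obtain \<mu> where "\<mu> \<in> star_couplings d1 d2"
    and "(\<integral>\<^sup>+ x. star_ext (\<lambda>(a, b). of_bool ((a, b) \<notin> S)) x \<partial>measure_pmf \<mu>) \<le> 0"
    using star_inf_attained[OF le] .
  then have \<mu>: "map_pmf fst \<mu> = d1" "map_pmf snd \<mu> = d2"
    and zero: "\<And>x. x \<in> set_pmf \<mu> \<Longrightarrow> star_ext (\<lambda>(a, b). of_bool ((a, b) \<notin> S)) x = 0"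
    by (auto simp: star_couplings_def nn_integral_0_iff_AE AE_measure_pmf_iff)
  have supp: "\<exists>a b. x = (Some a, Some b) \<and> (a, b) \<in> S" if "x \<in> set_pmf \<mu>" for x
  proof -
    have "fst x \<in> set_pmf d1" "snd x \<in> set_pmf d2" using that by (auto simp flip: \<mu>)
    then obtain a b where x: "x = (Some a, Some b)" using None
      by (cases x; cases "fst x"; cases "snd x") auto
    then show ?thesis using zero[OF that] by auto
  qed
  let ?j = "\<lambda>(x, y). Some (the x, the y)"
  have "map_spmf fst (map_pmf ?j \<mu>) = map_pmf fst \<mu>" "map_spmf snd (map_pmf ?j \<mu>) = map_pmf snd \<mu>"
    unfolding pmf.map_comp by (rule pmf.map_cong0; use supp in fastforce)+
  moreover have "set_spmf (map_pmf ?j \<mu>) \<subseteq> S"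
    using supp by (fastforce simp: in_set_spmf)
  ultimately show ?thesis using \<mu> by (auto simp: is_coupling_def)
qed

section \<open>Soundness and completeness\<close>

context lang
begin

section \<open>Semantic bounds for loops\<close>

lemma sem_While_tendsto:
  "(\<lambda>n. pmf (while_approx (bv b) (sem C) n m) x) \<longlonglongrightarrow> pmf (sem (While b C) m) x"
  by (simp add: pmf_lub_spmf_tendsto while_approx_mono)

lemma nn_integral_sem_While:
  "(\<integral>\<^sup>+ x. f x \<partial>measure_spmf (sem (While b C) m)) =
    (SUP n. \<integral>\<^sup>+ x. f x \<partial>measure_spmf (while_approx (bv b) (sem C) n m))"
  by (simp add: nn_integral_lub_spmf while_approx_mono)

text \<open>Induction over unrollings run in lockstep, followed by the limit. The zeroth unrolling
  costs nothing; a common guard value means one more body step or a common exit; differing guard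
  values make the right-hand side infinite.\<close>

lemma star_inf_While:
  assumes body: "\<And>m1 m2. bv b m1 \<Longrightarrow> bv b' m2 \<Longrightarrow>
    star_inf (sem C m1) (sem D m2) ((\<lambda>(m1, m2). bv b m1 \<longleftrightarrow> bv b' m2) \<triangleright> \<phi>) \<le> \<phi> (m1, m2)"
  shows "star_inf (sem (While b C) m1) (sem (While b' D) m2) ((\<lambda>(m1, m2). \<not> bv b m1 \<and> \<not> bv b' m2) \<triangleright> \<phi>)
    \<le> ((\<lambda>(m1, m2). bv b m1 \<longleftrightarrow> bv b' m2) \<triangleright> \<phi>) (m1, m2)"
proof (rule star_inf_le_limit[OF sem_While_tendsto sem_While_tendsto])
  fix n
  show "star_inf (while_approx (bv b) (sem C) n m1) (while_approx (bv b') (sem D) n m2)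
      ((\<lambda>(m1, m2). \<not> bv b m1 \<and> \<not> bv b' m2) \<triangleright> \<phi>)
    \<le> ((\<lambda>(m1, m2). bv b m1 \<longleftrightarrow> bv b' m2) \<triangleright> \<phi>) (m1, m2)"
  proof (induction n arbitrary: m1 m2)
    case 0
    show ?case by (simp add: star_inf_None_left)
  next
    case (Suc n)
    show ?case
    proof (cases "bv b m1 \<longleftrightarrow> bv b' m2")
      case True
      show ?thesis
      proof (cases "bv b m1")
        case b: True
        with True have b': "bv b' m2" by simp
        show ?thesis
          using star_inf_bind_le[OF Suc.IH body[OF b b']] b b' by (simp add: guard_True)
      next
        case False
        with True show ?thesis
          using star_inf_return[of m1 m2 "(\<lambda>(m1, m2). \<not> bv b m1 \<and> \<not> bv b' m2) \<triangleright> \<phi>"]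
            by (simp add: guard_True)
      qed
    qed (simp add: guard_def)
  qed
qed

lemma star_inf_While_L:
  assumes body: "\<And>m1. bv b m1 \<Longrightarrow> star_inf (sem C m1) (return_spmf m2) \<phi> \<le> \<phi> (m1, m2)"
  shows "star_inf (sem (While b C) m1) (return_spmf m2) ((\<lambda>(m1, m2). \<not> bv b m1) \<triangleright> \<phi>) \<le> \<phi> (m1, m2)"
proof (rule star_inf_le_limit[OF sem_While_tendsto tendsto_const])
  fix n
  show "star_inf (while_approx (bv b) (sem C) n m1) (return_spmf m2) ((\<lambda>(m1, m2). \<not> bv b m1) \<triangleright> \<phi>)
    \<le> \<phi> (m1, m2)"
  proof (induction n arbitrary: m1)
    case 0
    show ?case by (simp add: star_inf_None_left)
  next
    case (Suc n)
    show ?case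
    proof (cases "bv b m1")
      case True
      \<comment> \<open>The idle side is written as a bind with \<open>return_spmf\<close>, so that
        the bound for sequential composition applies.\<close>
      have "star_inf (bind_spmf (sem C m1) (while_approx (bv b) (sem C) n)) (bind_spmf (return_spmf m2) return_spmf)
        ((\<lambda>(m1, m2). \<not> bv b m1) \<triangleright> \<phi>) \<le> \<phi> (m1, m2)"
        by (rule star_inf_bind_le[OF _ body[OF True]]) (use Suc.IH in auto)
      then show ?thesis using True by simp
    next
      case False
      then show ?thesis
        using star_inf_return[of m1 m2 "(\<lambda>(m1, m2). \<not> bv b m1) \<triangleright> \<phi>"] by (simp add: guard_True)
    qed
  qed
qed

lemma star_inf_While_R:
  assumes body: "\<And>m2. bv b m2 \<Longrightarrow> star_inf (return_spmf m1) (sem D m2) \<phi> \<le> \<phi> (m1, m2)"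
  shows "star_inf (return_spmf m1) (sem (While b D) m2) ((\<lambda>(m1, m2). \<not> bv b m2) \<triangleright> \<phi>) \<le> \<phi> (m1, m2)"
proof (rule star_inf_le_limit[OF tendsto_const sem_While_tendsto])
  fix n
  show "star_inf (return_spmf m1) (while_approx (bv b) (sem D) n m2) ((\<lambda>(m1, m2). \<not> bv b m2) \<triangleright> \<phi>)
    \<le> \<phi> (m1, m2)"
  proof (induction n arbitrary: m2)
    case 0
    show ?case by (simp add: star_inf_None_right)
  next
    case (Suc n)
    show ?case
    proof (cases "bv b m2")
      case True
      have "star_inf (bind_spmf (return_spmf m1) return_spmf) (bind_spmf (sem D m2) (while_approx (bv b) (sem D) n))
        ((\<lambda>(m1, m2). \<not> bv b m2) \<triangleright> \<phi>) \<le> \<phi> (m1, m2)"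
        by (rule star_inf_bind_le[OF _ body[OF True]]) (use Suc.IH in auto)
      then show ?thesis using True by simp
    next
      case False
      then show ?thesis
        using star_inf_return[of m1 m2 "(\<lambda>(m1, m2). \<not> bv b m2) \<triangleright> \<phi>"] by (simp add: guard_True)
    qed
  qed
qed

section \<open>Soundness of the proof system\<close>

lemma sem_unit_eq: "unit_eq C D \<Longrightarrow> sem C = sem D"
proof (induction rule: unit_eq.induct)
  case (right C)
  show ?case by (simp add: fun_eq_iff)
qed (simp_all cong: if_cong)

text \<open>Rule induction on the semantic reading of a judgment. The axioms exhibit a coupling;
  sequencing, loops and the Strassen rules rest on attained minima and their limits.\<close>

theorem eRHL_sound:
  assumes "eRHL Z \<Phi> C D \<Psi>" "z \<in> Z"
  shows "star_inf (sem C m1) (sem D m2) (\<Psi> z) \<le> \<Phi> z (m1, m2)"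
  using assms
proof (induction arbitrary: z m1 m2 rule: eRHL.induct)
  case (Skip Z \<Phi>)
  show ?case by (simp add: star_inf_return)
next
  case (Asgn Z \<Phi> x e y e')
  show ?case using star_inf_return by simp
next
  case (Sample Z \<mu> s s' \<Phi> x y)
  have c: "map_spmf fst (\<mu> m1 m2) = spmf_of_pmf (sv s m1)" "map_spmf snd (\<mu> m1 m2) = spmf_of_pmf (sv s' m2)"
    using Sample by (auto simp: is_coupling_def)
  \<comment> \<open>The coupling of the sampled values is pushed forward along the two memory
    updates.\<close>
  have "is_coupling (map_spmf (\<lambda>(v1, v2). (m1(x := v1), m2(y := v2))) (\<mu> m1 m2))
    (sem (Sample x s) m1) (sem (Sample y s') m2)"
    using arg_cong[OF c(1), of "map_spmf (\<lambda>v. m1(x := v))"] arg_cong[OF c(2), of "map_spmf (\<lambda>v. m2(y := v))"]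
    by (simp add: is_coupling_def spmf.map_comp o_def split_def)
  from star_inf_le_coupling[OF this, of "\<Phi> z"] show ?case
    by (simp add: split_def o_def)
next
  case (If Z b b' \<Phi> C1 D1 \<Psi> C2 D2)
  show ?case using If.IH(1)[OF If.prems, of m1 m2] If.IH(2)[OF If.prems, of m1 m2]
    by (auto simp: guard_def)
next
  case (While Z b b' \<Phi> C D)
  show ?case
  proof (rule star_inf_While)
    show "star_inf (sem C m1) (sem D m2) ((\<lambda>(m1, m2). bv b m1 \<longleftrightarrow> bv b' m2) \<triangleright> \<Phi> z) \<le> \<Phi> z (m1, m2)"
      if "bv b m1" "bv b' m2" for m1 m2
      using While.IH[OF While.prems, of m1 m2] that by (simp add: guard_True)
  qed
next
  case (Seq Z \<Phi> C1 D1 \<Theta> C2 D2 \<Psi>)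
  show ?case unfolding sem.simps
    by (rule star_inf_bind_le[where \<theta> = "\<Theta> z"]) (use Seq in auto)
next
  case (Unit Z \<Phi> C D \<Psi> C' D')
  then show ?case using sem_unit_eq[OF \<open>unit_eq C C'\<close>] sem_unit_eq[OF \<open>unit_eq D D'\<close>] by auto
next
  case (Asgn_L Z \<Phi> x e)
  show ?case using star_inf_return by simp
next
  case (Asgn_R Z \<Phi> y e)
  show ?case using star_inf_return by simp
next
  case (Sample_L Z s \<Phi> x)
  have "is_coupling (spmf_of_pmf (map_pmf (\<lambda>v. (m1(x := v), m2)) (sv s m1))) (sem (Sample x s) m1) (sem Skip m2)"
    by (simp add: is_coupling_def pmf.map_comp o_def)
  from star_inf_le_coupling[OF this, of "\<Phi> z"] show ?case by simp
next
  case (Sample_R Z s \<Phi> y)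
  have "is_coupling (spmf_of_pmf (map_pmf (\<lambda>v. (m1, m2(y := v))) (sv s m2))) (sem Skip m1) (sem (Sample y s) m2)"
    by (simp add: is_coupling_def pmf.map_comp o_def)
  from star_inf_le_coupling[OF this, of "\<Phi> z"] show ?case by simp
next
  case (If_L Z b \<Phi> C1 \<Psi> C2)
  show ?case using If_L.IH(1)[OF If_L.prems, of m1 m2] If_L.IH(2)[OF If_L.prems, of m1 m2]
    by (auto simp: guard_def)
next
  case (If_R Z b \<Phi> D1 \<Psi> D2)
  show ?case using If_R.IH(1)[OF If_R.prems, of m1 m2] If_R.IH(2)[OF If_R.prems, of m1 m2]
    by (auto simp: guard_def)
next
  case (While_L Z b \<Phi> C)
  have "star_inf (sem (While b C) m1) (return_spmf m2) ((\<lambda>(m1, m2). \<not> bv b m1) \<triangleright> \<Phi> z) \<le> \<Phi> z (m1, m2)"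
  proof (rule star_inf_While_L)
    show "star_inf (sem C m1) (return_spmf m2) (\<Phi> z) \<le> \<Phi> z (m1, m2)" if "bv b m1" for m1
      using While_L.IH[OF While_L.prems, of m1 m2] that by (simp add: guard_def)
  qed
  then show ?case by simp
next
  case (While_R Z b \<Phi> D)
  have "star_inf (return_spmf m1) (sem (While b D) m2) ((\<lambda>(m1, m2). \<not> bv b m2) \<triangleright> \<Phi> z) \<le> \<Phi> z (m1, m2)"
  proof (rule star_inf_While_R)
    show "star_inf (return_spmf m1) (sem D m2) (\<Phi> z) \<le> \<Phi> z (m1, m2)" if "bv b m2" for m2
      using While_R.IH[OF While_R.prems, of m1 m2] that by (simp add: guard_def)
  qed
  then show ?case by simp
next
  case (Conseq Z' \<Phi>' C D \<Psi>' Z \<Phi> \<Psi>)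
  \<comment> \<open>The side condition is instantiated at the output distributions of the two
    programs.\<close>
  then show ?case by blast
next
  case (Nmod_L x C Z \<Phi> D \<Psi>)
  \<comment> \<open>The logical variable records the initial value of \<open>x\<close>, which makes
    the guard true. In every final memory \<open>x\<close> still has this value, so the update in
    the postcondition changes nothing.\<close>
  have "ValPair (m1 x) z \<in> Val_times Z" using Nmod_L.prems by (auto simp: Val_times_def)
  from Nmod_L.IH[OF this, of m1 m2]
  have "star_inf (sem C m1) (sem D m2) (\<lambda>(m1', m2'). \<Psi> z (m1'(x := m1 x), m2')) \<le> \<Phi> z (m1, m2)"
    by (simp add: val_abs_def guard_def)
  moreover have "star_inf (sem C m1) (sem D m2) (\<Psi> z) \<le>
    star_inf (sem C m1) (sem D m2) (\<lambda>(m1', m2'). \<Psi> z (m1'(x := m1 x), m2'))"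
  proof (rule star_inf_mono)
    fix a b assume "a \<in> set_spmf (sem C m1)"
    then have "a x = m1 x" using Nmod_L.hyps by (auto simp: unmodified_def)
    then have "a(x := m1 x) = a" by auto
    then show "\<Psi> z (a, b) \<le> (case (a, b) of (m1', m2') \<Rightarrow> \<Psi> z (m1'(x := m1 x), m2'))" by simp
  qed
  ultimately show ?case by simp
next
  case (Nmod_R y D Z \<Phi> C \<Psi>)
  have "ValPair (m2 y) z \<in> Val_times Z" using Nmod_R.prems by (auto simp: Val_times_def)
  from Nmod_R.IH[OF this, of m1 m2]
  have "star_inf (sem C m1) (sem D m2) (\<lambda>(m1', m2'). \<Psi> z (m1', m2'(y := m2 y))) \<le> \<Phi> z (m1, m2)"
    by (simp add: val_abs_def guard_def)
  moreover have "star_inf (sem C m1) (sem D m2) (\<Psi> z) \<le>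
    star_inf (sem C m1) (sem D m2) (\<lambda>(m1', m2'). \<Psi> z (m1', m2'(y := m2 y)))"
  proof (rule star_inf_mono)
    fix a b assume "b \<in> set_spmf (sem D m2)"
    then have "b y = m2 y" using Nmod_R.hyps by (auto simp: unmodified_def)
    then have "b(y := m2 y) = b" by auto
    then show "\<Psi> z (a, b) \<le> (case (a, b) of (m1', m2') \<Rightarrow> \<Psi> z (m1', m2'(y := m2 y)))" by simp
  qed
  ultimately show ?case by simp
next
  case (Strassen_down C D Z \<Phi> R)
  from Strassen_down.prems obtain M z' where z: "z = SetPair M z'" "z' \<in> Z"
    by (auto simp: Pow_times_def)
  obtain \<mu> where "\<mu> \<in> star_couplings (sem C m1) (sem D m2)"
    and le: "(\<integral>\<^sup>+ x. star_ext (\<lambda>(m1, m2). of_bool ((m1, m2) \<notin> R z')) x \<partial>measure_pmf \<mu>) \<le> \<Phi> z' (m1, m2)"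
    using star_inf_attained[OF Strassen_down.IH[OF z(2)]] .
  then have "star_inf (sem C m1) (sem D m2) (\<lambda>(m1, m2). of_bool (m1 \<in> M) + of_bool (m2 \<notin> R z' `` M)) \<le>
    (\<integral>\<^sup>+ x. star_ext (\<lambda>(m1, m2). of_bool (m1 \<in> M) + of_bool (m2 \<notin> R z' `` M)) x \<partial>measure_pmf \<mu>)"
    by (intro star_inf_le) (auto simp: star_couplings_def)
  \<comment> \<open>If \<open>m1\<close> is in \<open>M\<close> and \<open>m2\<close> lies outside
    the image of \<open>M\<close> under \<open>R z'\<close>, then the pair is not in
    \<open>R z'\<close>; so the sum is two only where the indicator on the right is one.\<close>
  also have "\<dots> \<le> (\<integral>\<^sup>+ x. 1 + star_ext (\<lambda>(m1, m2). of_bool ((m1, m2) \<notin> R z')) x \<partial>measure_pmf \<mu>)"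
  proof (rule nn_integral_mono)
    fix x
    show "star_ext (\<lambda>(m1, m2). of_bool (m1 \<in> M) + of_bool (m2 \<notin> R z' `` M)) x
      \<le> 1 + star_ext (\<lambda>(m1, m2). of_bool ((m1, m2) \<notin> R z')) x"
      by (cases x; cases "fst x"; cases "snd x") auto
  qed
  also have "\<dots> = 1 + (\<integral>\<^sup>+ x. star_ext (\<lambda>(m1, m2). of_bool ((m1, m2) \<notin> R z')) x \<partial>measure_pmf \<mu>)"
    by (subst nn_integral_add) simp_all
  also have "\<dots> \<le> 1 + \<Phi> z' (m1, m2)" using le by (rule add_left_mono)
  finally show ?case by (simp add: z set_abs_def)
next
  case (Strassen_up C D Z \<Phi> R)
  \<comment> \<open>The premise speaks about \<open>SetPair M z\<close> for every \<open>M\<close>,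
    which supplies the whole family of Hall inequalities.\<close>
  show ?case
  proof (rule star_inf_strassen)
    show "star_inf (sem C m1) (sem D m2) (\<lambda>(a, b). of_bool (a \<in> M) + of_bool (b \<notin> R z `` M)) \<le> 1 + \<Phi> z (m1, m2)" for M
    proof -
      have "SetPair M z \<in> Pow_times Z" using Strassen_up.prems by (auto simp: Pow_times_def)
      from Strassen_up.IH[OF this, of m1 m2] show ?thesis by (simp add: set_abs_def)
    qed
  qed (use Strassen_up.hyps in \<open>auto simp: ast_def\<close>)
qed

section \<open>Completeness through exact one-sided expectations\<close>

lemma eRHL_weaken:
  assumes "eRHL Z \<Phi>' C D \<Psi>'" "Z \<noteq> {}"
    and "\<And>z m1 m2. z \<in> Z \<Longrightarrow> \<Phi>' z (m1, m2) \<le> \<Phi> z (m1, m2)"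
    and "\<And>z m1 m2. z \<in> Z \<Longrightarrow> \<Psi> z (m1, m2) \<le> \<Psi>' z (m1, m2)"
  shows "eRHL Z \<Phi> C D \<Psi>"
  using assms(1,2)
proof (rule Conseq, intro allI impI ballI)
  fix m1 m2 d1 d2 z assume *: "\<forall>z\<in>Z. star_inf d1 d2 (\<Psi>' z) \<le> \<Phi>' z (m1, m2)" and z: "z \<in> Z"
  have "star_inf d1 d2 (\<Psi> z) \<le> star_inf d1 d2 (\<Psi>' z)" using assms(4)[OF z] by (intro star_inf_mono)
  also have "\<dots> \<le> \<Phi>' z (m1, m2)" using * z by blast
  also have "\<dots> \<le> \<Phi> z (m1, m2)" using assms(3)[OF z] .
  finally show "star_inf d1 d2 (\<Psi> z) \<le> \<Phi> z (m1, m2)" .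
qed

lemma eRHL_strengthen_pre:
  assumes "eRHL Z \<Phi>' C D \<Psi>" "Z \<noteq> {}"
    and "\<And>z m1 m2. z \<in> Z \<Longrightarrow> \<Phi>' z (m1, m2) \<le> \<Phi> z (m1, m2)"
  shows "eRHL Z \<Phi> C D \<Psi>"
  by (rule eRHL_weaken[OF assms(1,2)]) (simp_all add: assms(3))

text \<open>Shows that the expected value of \<open>f\<close> after the loop can serve as an
  invariant of \<open>While_L\<close> and \<open>While_R\<close>. Monotone convergence moves the
  supremum out of the integral.\<close>

lemma nn_integral_While_body:
  assumes "bv b m"
  shows "(\<integral>\<^sup>+ m'. \<integral>\<^sup>+ x. f x \<partial>measure_spmf (sem (While b C) m') \<partial>measure_spmf (sem C m))
    \<le> (\<integral>\<^sup>+ x. f x \<partial>measure_spmf (sem (While b C) m))"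
proof -
  let ?W = "while_approx (bv b) (sem C)"
  have "(\<integral>\<^sup>+ m'. \<integral>\<^sup>+ x. f x \<partial>measure_spmf (sem (While b C) m') \<partial>measure_spmf (sem C m)) =
    (\<integral>\<^sup>+ m'. (SUP n. \<integral>\<^sup>+ x. f x \<partial>measure_spmf (?W n m')) \<partial>measure_spmf (sem C m))"
    by (simp only: nn_integral_sem_While)
  also have "\<dots> = (SUP n. \<integral>\<^sup>+ m'. \<integral>\<^sup>+ x. f x \<partial>measure_spmf (?W n m') \<partial>measure_spmf (sem C m))"
  proof (rule nn_integral_monotone_convergence_SUP)
    show "incseq (\<lambda>n m'. \<integral>\<^sup>+ x. f x \<partial>measure_spmf (?W n m'))"
      by (auto simp: incseq_def le_fun_def nn_integral_measure_spmf
          intro!: nn_integral_mono mult_right_mono ennreal_leI ord_spmf_eq_leD while_approx_mono)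
  qed simp
  \<comment> \<open>Prefixing the body turns unrolling \<open>n\<close> into unrolling
    \<open>Suc n\<close>, and the supremum over the shifted indices is at most the full one.\<close>
  also have "\<dots> = (SUP n. \<integral>\<^sup>+ x. f x \<partial>measure_spmf (?W (Suc n) m))"
    using assms by (simp add: nn_integral_bind_spmf)
  also have "\<dots> \<le> (SUP n. \<integral>\<^sup>+ x. f x \<partial>measure_spmf (?W n m))"
    by (rule SUP_mono) blast
  finally show ?thesis by (simp only: nn_integral_sem_While)
qed

lemma nn_integral_While_exit:
  assumes "\<not> bv b m"
  shows "f m \<le> (\<integral>\<^sup>+ x. f x \<partial>measure_spmf (sem (While b C) m))"
proof -
  \<comment> \<open>Index 1, because unrolling 0 is the zero sub-distribution, while unrolling 1
    already returns \<open>m\<close> when the guard fails.\<close>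
  have "f m = (\<integral>\<^sup>+ x. f x \<partial>measure_spmf (while_approx (bv b) (sem C) 1 m))"
    using assms by (simp add: nn_integral_return_spmf)
  also have "\<dots> \<le> (\<integral>\<^sup>+ x. f x \<partial>measure_spmf (sem (While b C) m))"
    unfolding nn_integral_sem_While by (rule SUP_upper) simp
  finally show ?thesis .
qed

text \<open>Structural induction with \<open>\<Psi>\<close> generalised, so that the middle
  assertion of a sequence can itself be such an expectation.\<close>

lemma eRHL_wp_L:
  assumes Z: "Z \<noteq> {}"
  shows "eRHL Z (\<lambda>z (m1, m2). \<integral>\<^sup>+ m. \<Psi> z (m, m2) \<partial>measure_spmf (sem C m1)) C Skip \<Psi>"
proof (induction C arbitrary: \<Psi>)
  case Skip
  show ?case by (rule eRHL_strengthen_pre[OF eRHL.Skip[OF Z] Z]) (simp_all add: nn_integral_return_spmf)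
next
  case (Assign x e)
  show ?case by (rule eRHL_strengthen_pre[OF Asgn_L[OF Z] Z]) (simp_all add: nn_integral_return_spmf)
next
  case (Sample x s)
  show ?case by (rule eRHL_strengthen_pre[OF Sample_L[OF Z] Z]) simp_all
next
  case (Seq C1 C2)
  have "eRHL Z (\<lambda>z (m1, m2). \<integral>\<^sup>+ m. \<Psi> z (m, m2) \<partial>measure_spmf (sem (Seq C1 C2) m1)) (Seq C1 C2) (Seq Skip Skip) \<Psi>"
    by (rule eRHL_strengthen_pre[OF eRHL.Seq[OF Seq.IH(1) Seq.IH(2)] Z]) (simp_all add: nn_integral_bind_spmf)
  then show ?case by (rule Unit) (rule unit_eq.refl unit_eq.left)+
next
  case (If b C1 C2)
  show ?case
    by (rule If_L; rule eRHL_strengthen_pre[OF _ Z], rule If.IH) (auto simp: guard_def)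
next
  case (While b C)
  \<comment> \<open>The invariant is the expectation of \<open>\<Psi>\<close> after the remaining
    loop. While the guard holds, a body step does not increase it on average; where the guard fails,
    it dominates \<open>\<Psi>\<close>.\<close>
  let ?I = "\<lambda>z (m1, m2). \<integral>\<^sup>+ m. \<Psi> z (m, m2) \<partial>measure_spmf (sem (While b C) m1)"
  have "eRHL Z (\<lambda>z. (\<lambda>(m1, m2). bv b m1) \<triangleright> ?I z) C Skip ?I"
    by (rule eRHL_strengthen_pre[OF While.IH Z]) (auto simp: guard_def nn_integral_While_body simp del: sem.simps)
  from While_L[OF this] show ?case
    by (rule eRHL_weaken[OF _ Z]) (auto simp: guard_def intro: nn_integral_While_exit simp del: sem.simps)
qed

lemma eRHL_wp_R:
  assumes Z: "Z \<noteq> {}"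
  shows "eRHL Z (\<lambda>z (m1, m2). \<integral>\<^sup>+ m. \<Psi> z (m1, m) \<partial>measure_spmf (sem D m2)) Skip D \<Psi>"
proof (induction D arbitrary: \<Psi>)
  case Skip
  show ?case by (rule eRHL_strengthen_pre[OF eRHL.Skip[OF Z] Z]) (simp_all add: nn_integral_return_spmf)
next
  case (Assign x e)
  show ?case by (rule eRHL_strengthen_pre[OF Asgn_R[OF Z] Z]) (simp_all add: nn_integral_return_spmf)
next
  case (Sample x s)
  show ?case by (rule eRHL_strengthen_pre[OF Sample_R[OF Z] Z]) simp_all
next
  case (Seq D1 D2)
  have "eRHL Z (\<lambda>z (m1, m2). \<integral>\<^sup>+ m. \<Psi> z (m1, m) \<partial>measure_spmf (sem (Seq D1 D2) m2)) (Seq Skip Skip) (Seq D1 D2) \<Psi>"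
    by (rule eRHL_strengthen_pre[OF eRHL.Seq[OF Seq.IH(1) Seq.IH(2)] Z]) (simp_all add: nn_integral_bind_spmf)
  then show ?case by (rule Unit) (rule unit_eq.refl unit_eq.left)+
next
  case (If b D1 D2)
  show ?case
    by (rule If_R; rule eRHL_strengthen_pre[OF _ Z], rule If.IH) (auto simp: guard_def)
next
  case (While b D)
  let ?I = "\<lambda>z (m1, m2). \<integral>\<^sup>+ m. \<Psi> z (m1, m) \<partial>measure_spmf (sem (While b D) m2)"
  have "eRHL Z (\<lambda>z. (\<lambda>(m1, m2). bv b m2) \<triangleright> ?I z) Skip D ?I"
    by (rule eRHL_strengthen_pre[OF While.IH Z]) (auto simp: guard_def nn_integral_While_body simp del: sem.simps)
  from While_R[OF this] show ?case
    by (rule eRHL_weaken[OF _ Z]) (auto simp: guard_def intro: nn_integral_While_exit simp del: sem.simps)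
qed

text \<open>\<open>C\<close> runs against \<open>Skip\<close>, then \<open>Skip\<close> against
  \<open>D\<close>. The precondition is the expectation of \<open>\<Psi>\<close> for independent
  outputs.\<close>

lemma eRHL_wp:
  assumes Z: "Z \<noteq> {}"
  shows "eRHL Z (\<lambda>z (m1, m2). \<integral>\<^sup>+ a. \<integral>\<^sup>+ b. \<Psi> z (a, b) \<partial>measure_spmf (sem D m2) \<partial>measure_spmf (sem C m1)) C D \<Psi>"
proof -
  have "eRHL Z (\<lambda>z (m1, m2). \<integral>\<^sup>+ a. \<integral>\<^sup>+ b. \<Psi> z (a, b) \<partial>measure_spmf (sem D m2) \<partial>measure_spmf (sem C m1))
    (Seq C Skip) (Seq Skip D) \<Psi>"
    by (rule eRHL_strengthen_pre[OF eRHL.Seq[OF eRHL_wp_L[OF Z] eRHL_wp_R[OF Z]] Z]) simp_all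
  then show ?thesis by (rule Unit) (rule unit_eq.right unit_eq.left)+
qed

section \<open>The equivalence with pRHL\<close>

text \<open>The coupling given by validity may correlate the outputs, while \<open>eRHL_wp\<close>
  evaluates independent ones. \<open>Strassen_up\<close> bridges the gap: the postcondition of its
  premise is a sum of functions of one memory each, so both give it the same expectation.\<close>

lemma pRHL_valid_imp_eRHL:
  assumes ast: "ast C" "ast D" and Z: "Z \<noteq> {}" and valid: "pRHL_valid R C D S"
  shows "eRHL Z (\<lambda>z (m1, m2). of_bool ((m1, m2) \<notin> R)) C D (\<lambda>z (m1, m2). of_bool ((m1, m2) \<notin> S))"
proof (rule Strassen_up[OF ast], rule eRHL_strengthen_pre[OF eRHL_wp])
  show "Pow_times Z \<noteq> {}" "Pow_times Z \<noteq> {}" using Z by (auto simp: Pow_times_def)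
  fix w m1 m2 assume "w \<in> Pow_times Z"
  then obtain M z where w: "w = SetPair M z" by (auto simp: Pow_times_def)
  let ?p = "measure_spmf (sem C m1)" and ?q = "measure_spmf (sem D m2)"
  have ll: "lossless_spmf (sem C m1)" "lossless_spmf (sem D m2)" using ast by (auto simp: ast_def)
  have one: "emeasure ?p UNIV = 1" "emeasure ?q UNIV = 1"
    using ll by (simp_all add: lossless_spmf_def measure_spmf.emeasure_eq_measure space_measure_spmf)
  \<comment> \<open>Both outputs being full distributions, the double integral splits into one term
    per marginal.\<close>
  have "(\<integral>\<^sup>+ a. \<integral>\<^sup>+ b. of_bool (a \<in> M) + of_bool (b \<notin> S `` M) \<partial>?q \<partial>?p) =
    (\<integral>\<^sup>+ a. of_bool (a \<in> M) + (\<integral>\<^sup>+ b. of_bool (b \<notin> S `` M) \<partial>?q) \<partial>?p)"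
    by (subst nn_integral_add) (simp_all add: one space_measure_spmf)
  also have "\<dots> = (\<integral>\<^sup>+ a. of_bool (a \<in> M) \<partial>?p) + (\<integral>\<^sup>+ b. of_bool (b \<notin> S `` M) \<partial>?q)"
    by (subst nn_integral_add) (simp_all add: one space_measure_spmf)
  also have "\<dots> \<le> 1 + of_bool ((m1, m2) \<notin> R)"
  proof (cases "(m1, m2) \<in> R")
    case True
    then obtain \<mu> where \<mu>: "map_spmf fst \<mu> = sem C m1" "map_spmf snd \<mu> = sem D m2" "set_spmf \<mu> \<subseteq> S"
      using valid by (auto simp: pRHL_valid_def is_coupling_def)
    \<comment> \<open>The two terms are recombined under \<open>\<mu>\<close>, whose support inside
      \<open>S\<close> prevents both indicators from being one.\<close>
    have "(\<integral>\<^sup>+ a. of_bool (a \<in> M) \<partial>?p) + (\<integral>\<^sup>+ b. of_bool (b \<notin> S `` M) \<partial>?q) =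
      (\<integral>\<^sup>+ x. of_bool (fst x \<in> M) + of_bool (snd x \<notin> S `` M) \<partial>measure_spmf \<mu>)"
      by (subst nn_integral_add) (simp_all add: o_def flip: \<mu>(1,2))
    also have "\<dots> \<le> (\<integral>\<^sup>+ x. 1 \<partial>measure_spmf \<mu>)"
    proof (rule nn_integral_mono_AE, unfold AE_measure_spmf_iff, rule ballI)
      fix x assume "x \<in> set_spmf \<mu>"
      then have "(fst x, snd x) \<in> S" using \<mu>(3) by auto
      then have "snd x \<in> S `` M" if "fst x \<in> M" using that by (rule ImageI)
      then show "of_bool (fst x \<in> M) + of_bool (snd x \<notin> S `` M) \<le> (1 :: ennreal)" by auto
    qed
    also have "\<dots> \<le> 1" by (simp add: measure_spmf.emeasure_eq_measure weight_spmf_le_1 del: space_measure_spmf)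
    finally show ?thesis using True by simp
  next
    case False
    \<comment> \<open>Off \<open>R\<close> the precondition is two, which bounds the expectation of
      any sum of two indicators.\<close>
    have "(\<integral>\<^sup>+ a. of_bool (a \<in> M) \<partial>?p) + (\<integral>\<^sup>+ b. of_bool (b \<notin> S `` M) \<partial>?q)
      \<le> (\<integral>\<^sup>+ a. 1 \<partial>?p) + (\<integral>\<^sup>+ b. 1 \<partial>?q)"
      by (intro add_mono nn_integral_mono) auto
    also have "\<dots> = 1 + 1" by (simp add: one space_measure_spmf)
    finally show ?thesis using False by simp
  qed
  finally show "(case (m1, m2) of (m1, m2) \<Rightarrow> \<integral>\<^sup>+ a. \<integral>\<^sup>+ b.
      set_abs (\<lambda>M z (m1, m2). of_bool (m1 \<in> M) + of_bool (m2 \<notin> S `` M)) w (a, b)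
      \<partial>measure_spmf (sem D m2) \<partial>measure_spmf (sem C m1))
    \<le> set_abs (\<lambda>M z (m1, m2). 1 + (case (m1, m2) of (m1, m2) \<Rightarrow> of_bool ((m1, m2) \<notin> R))) w (m1, m2)"
    by (simp add: w set_abs_def)
qed

text \<open>On \<open>R\<close> the precondition is zero, so soundness gives optimal cost zero for
  the two outputs.\<close>

lemma eRHL_imp_pRHL_valid:
  assumes "ast C" "ast D" "z \<in> Z"
    and "eRHL Z (\<lambda>z (m1, m2). of_bool ((m1, m2) \<notin> R)) C D (\<lambda>z (m1, m2). of_bool ((m1, m2) \<notin> S))"
  shows "pRHL_valid R C D S"
  unfolding pRHL_valid_def
proof (intro ballI, clarify)
  fix m1 m2 assume "(m1, m2) \<in> R"
  then show "\<exists>\<mu>. is_coupling \<mu> (sem C m1) (sem D m2) \<and> set_spmf \<mu> \<subseteq> S"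
    using eRHL_sound[OF assms(4,3), of m1 m2] assms(1,2)
    by (intro coupling_of_star_inf_zero) (auto simp: ast_def)
qed

end

theorem theorem5p3:
  fixes ev :: "'e \<Rightarrow> ('x::countable, 'v::countable) mem \<Rightarrow> 'v"
    and bv :: "'b \<Rightarrow> ('x, 'v) mem \<Rightarrow> bool"
    and sv :: "'s \<Rightarrow> ('x, 'v) mem \<Rightarrow> 'v pmf"
    and C D :: "('x, 'e, 'b, 's) stmt"
    and R S :: "(('x, 'v) mem \<times> ('x, 'v) mem) set"
    and z0 :: "('x, 'v, 'z) lvar"
  assumes "lang.ast ev bv sv C" and "lang.ast ev bv sv D"
  shows "lang.pRHL_valid ev bv sv R C D S \<longleftrightarrow>
    lang.eRHL ev bv sv {z0}
      (\<lambda>z (m1, m2). of_bool ((m1, m2) \<notin> R)) C D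
      (\<lambda>z (m1, m2). of_bool ((m1, m2) \<notin> S))"
  using lang.pRHL_valid_imp_eRHL[OF assms, of "{z0}"] lang.eRHL_imp_pRHL_valid[OF assms, of z0 "{z0}"]
  by blast

end
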